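(* Fix a positive integer $r$ and real numbers $0<c_0<1$ and $\eta>0$. Then there exists a constant $P$, depending only on $(r,c_0,\eta)$, such that for every prime $p\geqslant P$, every $M,N$ satisfying $M^4N^2\geqslant p^{1+\frac1r+\eta}$, and all sets of integers $\mathcal{M},\mathcal{N}\subseteq[1,p]$ with $$\mathcal{M}\subseteq[M,2M],\quad \mathcal{N}\subseteq[N,2N],\quad \#\mathcal{M}\geqslant c_0M,\quad \#\mathcal{N}\geqslant c_0N,$$ there exist $m\in\mathcal{M}$, $n\in\mathcal{N}$ and a positive integer $k$ with $$k\leqslant p^{1+\frac1r+\eta}(MN)^{-2}+p^{\eta}$$ such that $mn+k$ is a quadratic residue modulo $p$. *)

theory Defs
  imports Complex_Main "HOL-Number_Theory.Number_Theory"
begin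

text \<open>
  The library predicate \<^term>\<open>QuadRes\<close> also holds for multiples of the modulus. As usual,
  a quadratic residue is required to be coprime to the modulus.
\<close>

definition quadratic_residue :: "nat \<Rightarrow> int \<Rightarrow> bool" where
  "quadratic_residue p a \<longleftrightarrow> coprime a (int p) \<and> QuadRes (int p) a"

end

theory Submission
  imports Defs "Berlekamp_Zassenhaus.Finite_Field" "HOL-Analysis.Convex"
begin

text \<open>
  Write \<open>\<chi>\<close> for the quadratic character modulo \<open>p\<close>. For \<open>u \<le> U\<close> and \<open>v \<le> V\<close> put \<open>x \<equiv> m n / u\<close>, so that
  \<open>\<chi>(m n + u v) = \<chi>(u) \<chi>(x + v)\<close>. If no \<open>m n + k\<close> with \<open>k \<le> U V\<close> is a residue, then each such \<open>x\<close>
  starts a run \<open>x + 1, \<dots>, x + V\<close> on which \<open>\<chi>\<close> takes only the value 0 and one fixed sign.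

  With \<open>V\<close> a small power of \<open>p\<close> there are only \<open>O(p\<^sup>1\<^sup>/\<^sup>2)\<close> such \<open>x\<close>. To see this, cut the run into \<open>s\<close> blocks,
  multiply the character sums over the blocks, square, and sum over all \<open>x\<close>. Expanding gives complete sums of
  \<open>\<chi>(f(x))\<close> for products \<open>f\<close> of \<open>2 s\<close> linear factors; unless both \<open>s\<close>-tuples of shifts agree, \<open>f\<close> has a
  simple root, and the sum is \<open>O(p\<^sup>1\<^sup>/\<^sup>2)\<close> by Stepanov's method.

  On the other hand \<open>U\<close> is chosen so that \<open>M N U\<close> is about \<open>p\<^sup>1\<^sup>/\<^sup>2\<^sup>+\<^sup>\<delta>\<close>, or \<open>U \<le> 2\<close> if \<open>M N\<close> is larger. A divisor bound
  controls the coincidences \<open>m n u' \<equiv> m' n' u\<close>, and Cauchy--Schwarz gives more than \<open>p\<^sup>1\<^sup>/\<^sup>2\<^sup>+\<^sup>\<delta>\<^sup>/\<^sup>2\<close> values of \<open>x\<close>,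
  up to a constant: a contradiction.
\<close>

section \<open>Stepanov's method over a prime field\<close>

text \<open>A pigeonhole count stands in for dimension theory: there are more coefficient families
  on \<open>U\<close> than value vectors on \<open>I\<close>, and the difference of two families
  with equal values is a nontrivial solution. The hypothesis \<open>diff\<close> is the form of
  linearity this uses.\<close>

lemma homogeneous_system_nontrivial:
  fixes L :: "'i \<Rightarrow> ('u \<Rightarrow> 'a::{finite,ab_group_add,zero_neq_one}) \<Rightarrow> 'a"
  assumes "finite I" "finite U" "card I < card U"
    and diff: "\<And>i c c'. L i (\<lambda>u. c u - c' u) = L i c - L i c'"
  obtains c where "\<And>u. u \<notin> U \<Longrightarrow> c u = 0" "\<exists>u\<in>U. c u \<noteq> 0" "\<And>i. i \<in> I \<Longrightarrow> L i c = 0"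
proof -
  let ?S = "PiE U (\<lambda>_. UNIV :: 'a set)" and ?T = "PiE I (\<lambda>_. UNIV :: 'a set)"
  let ?F = "\<lambda>c. restrict (\<lambda>i. L i c) I"
  have q: "CARD('a) > 1"
    using card_mono[of UNIV "{0, 1 :: 'a}"] by simp
  have finT: "finite ?T" using assms by (intro finite_PiE) auto
  have "card (?F ` ?S) \<le> card ?T"
    by (intro card_mono finT) auto
  also have "\<dots> < card ?S"
    using assms q by (simp add: card_PiE)
  finally have "\<not> inj_on ?F ?S"
    by (rule pigeonhole)
  then obtain c c' where c: "c \<in> ?S" "c' \<in> ?S" "?F c = ?F c'" "c \<noteq> c'"
    by (auto simp: inj_on_def)
  show ?thesis
  proof (rule that[of "\<lambda>u. c u - c' u"])
    show "c u - c' u = 0" if "u \<notin> U" for u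
      using that c by (auto simp: PiE_def extensional_def)
    show "\<exists>u\<in>U. c u - c' u \<noteq> 0"
      using c by (metis PiE_ext right_minus_eq)
    show "L i (\<lambda>u. c u - c' u) = 0" if "i \<in> I" for i
      using fun_cong[OF c(3), of i] that by (simp add: diff)
  qed
qed

text \<open>A derivative lowers the order of a root by exactly 1 as long as that order is nonzero in
  the field. The condition \<open>l \<le> CHAR('a)\<close> secures this for every order that
  occurs.\<close>

lemma linear_power_dvd_of_higher_pderiv:
  fixes P :: "'a::field poly"
  assumes "\<And>k. k < l \<Longrightarrow> poly ((pderiv ^^ k) P) a = 0" and "l \<le> CHAR('a)"
  shows "[:- a, 1:] ^ l dvd P"
  using assms
proof (induction l arbitrary: P)
  case 0
  then show ?case by simp
next
  case (Suc l)
  have IH: "[:- a, 1:] ^ l dvd pderiv P"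
  proof (rule Suc.IH)
    show "poly ((pderiv ^^ k) (pderiv P)) a = 0" if "k < l" for k
      using Suc.prems(1)[of "Suc k"] that by (simp add: funpow_swap1)
  qed (use Suc.prems in simp)
  show ?case
  proof (rule ccontr)
    assume nd: "\<not> [:- a, 1:] ^ Suc l dvd P"
    then have P: "P \<noteq> 0" by auto
    define n where "n = order a P"
    have n: "n \<le> l"
      using nd P unfolding order_divides n_def by auto
    have "n > 0"
      using Suc.prems(1)[of 0] P by (simp add: n_def order_gt_0_iff)
    then obtain n' where n': "n = Suc n'" by (cases n) auto
    obtain g where g: "P = [:- a, 1:] ^ n * g" "\<not> [:- a, 1:] dvd g"
      using order_decomp[OF P, of a] n_def by auto
    have "pderiv (X ^ n * g) = X ^ n' * (smult (of_nat n) g + X * pderiv g)"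
      if "pderiv X = 1" for X
      unfolding n' pderiv_mult pderiv_power_Suc that by (simp add: algebra_simps)
    then have "pderiv P = [:- a, 1:] ^ n' * (smult (of_nat n) g + [:- a, 1:] * pderiv g)"
      unfolding g(1) by (simp add: pderiv_pCons)
    moreover have "[:- a, 1:] ^ Suc n' dvd pderiv P"
      using IH n n' by (meson dvd_trans le_imp_power_dvd)
    ultimately have "[:- a, 1:] dvd smult (of_nat n) g + [:- a, 1:] * pderiv g"
      by (metis dvd_mult_cancel_left pCons_eq_0_iff power_Suc2 power_eq_0_iff zero_neq_one)
    then have "poly (smult (of_nat n) g) a = 0"
      by (simp add: poly_eq_0_iff_dvd[symmetric] del: mult_eq_0_iff)
    moreover have "poly g a \<noteq> 0"
      using g(2) by (simp add: poly_eq_0_iff_dvd)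
    moreover have "(of_nat n :: 'a) \<noteq> 0"
      using n Suc.prems(2) \<open>n > 0\<close> unfolding of_nat_eq_0_iff_char_dvd by (auto dest!: dvd_imp_le)
    ultimately show False by simp
  qed
qed

lemma card_mult_le_degree:
  fixes P :: "'a::idom poly"
  assumes "P \<noteq> 0" and "\<And>x. x \<in> S \<Longrightarrow> [:- x, 1:] ^ l dvd P"
  shows "card S * l \<le> degree P"
proof (cases "l = 0")
  case False
  have S: "S \<subseteq> {x. poly P x = 0}"
    using assms False order_root order_divides by fastforce
  then have "finite S"
    using assms(1) poly_roots_finite finite_subset by blast
  have "card S * l \<le> (\<Sum>x\<in>S. order x P)"
    using assms sum_bounded_below[of S l "\<lambda>x. order x P"] by (simp add: order_divides)
  also have "\<dots> \<le> (\<Sum>x | poly P x = 0. order x P)"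
    using assms(1) S by (intro sum_mono2) (auto simp: poly_roots_finite)
  also have "\<dots> = size (proots P)"
    using assms(1) by (simp add: size_multiset_overloaded_eq)
  finally show ?thesis
    using size_proots_le[of P] by simp
qed simp

text \<open>
  The operator \<open>r \<mapsto> n f' r + f r'\<close> describes the derivative of \<open>f\<^sup>n r\<close> after division by \<open>f\<^sup>n\<^sup>-\<^sup>1\<close>.
\<close>

primrec reduced_pderiv :: "'a::field poly \<Rightarrow> nat \<Rightarrow> nat \<Rightarrow> 'a poly \<Rightarrow> 'a poly" where
  "reduced_pderiv f n 0 r = r"
| "reduced_pderiv f n (Suc k) r =
     smult (of_nat (n - k)) (pderiv f * reduced_pderiv f n k r) + f * pderiv (reduced_pderiv f n k r)"

text \<open>The power of \<open>f\<close> is kept outside because at a point with f(x)^m = 1 the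
  factors for \<open>n = l\<close> and \<open>n = l + m\<close> coincide and can be pulled out
  together.\<close>

lemma higher_pderiv_power_mult:
  assumes "k \<le> n"
  shows "(pderiv ^^ k) (f ^ n * r) = f ^ (n - k) * reduced_pderiv f n k r"
  using assms
proof (induction k)
  case (Suc k)
  then obtain e where e: "n - k = Suc e" "n - Suc k = e"
    by (metis Suc_diff_Suc Suc_le_eq)
  have "pderiv (f ^ Suc e * q) = f ^ e * (smult (of_nat (Suc e)) (pderiv f * q) + f * pderiv q)" for q
    unfolding pderiv_mult pderiv_power_Suc by (simp add: algebra_simps)
  then show ?case
    using Suc e by simp
qed simp

lemma reduced_pderiv_diff:
  "reduced_pderiv f n k (r - r') = reduced_pderiv f n k r - reduced_pderiv f n k r'"
  by (induction k) (simp_all add: pderiv_diff right_diff_distrib smult_diff_right)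

text \<open>The bound does not involve \<open>n\<close>. This keeps the number of linear conditions
  small even when the exponent of \<open>f\<close> is of the size of the field.\<close>

lemma degree_reduced_pderiv:
  "degree (reduced_pderiv f n k r) \<le> degree r + k * degree f"
proof (induction k)
  case (Suc k)
  let ?q = "reduced_pderiv f n k r"
  have "degree (smult (of_nat (n - k)) (pderiv f * ?q)) \<le> degree f + degree ?q"
    using degree_smult_le[of "of_nat (n - k)" "pderiv f * ?q"] degree_mult_le[of "pderiv f" ?q]
      degree_pderiv_le[of f] by linarith
  moreover have "degree (f * pderiv ?q) \<le> degree f + degree ?q"
    using degree_mult_le[of f "pderiv ?q"] degree_pderiv_le[of ?q] by simp
  ultimately show ?case
    using Suc by (auto intro!: degree_add_le)
qed simp

text \<open>Meant for the monomials X^(p j), which behave like constants under differentiation in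
  characteristic p.\<close>

lemma higher_pderiv_mult_of_pderiv_eq_0:
  fixes g :: "'a::field poly"
  assumes "pderiv c = 0"
  shows "(pderiv ^^ k) (c * g) = c * (pderiv ^^ k) g"
  by (induction k) (simp_all add: pderiv_mult assms)

lemma higher_pderiv_sum:
  fixes g :: "'b \<Rightarrow> 'a::field poly"
  shows "(pderiv ^^ k) (\<Sum>j\<in>A. g j) = (\<Sum>j\<in>A. (pderiv ^^ k) (g j))"
  by (induction k) (simp_all add: pderiv_sum)

lemma higher_pderiv_add:
  fixes g :: "'a::field poly"
  shows "(pderiv ^^ k) (g + h) = (pderiv ^^ k) g + (pderiv ^^ k) h"
  by (induction k) (simp_all add: pderiv_add)

text \<open>Write f = f(0) + X g and apply the Frobenius map: f^p = f(0)^p + X^p g^p.\<close>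

lemma X_power_dvd_power_char:
  fixes f :: "'a::field_prime_char poly"
  shows "monom 1 CHAR('a) dvd f ^ CHAR('a) - [:poly f 0 ^ CHAR('a):]"
proof -
  let ?p = "CHAR('a)"
  obtain g where g: "f = [:poly f 0:] + monom 1 1 * g"
    by (cases f) (auto simp: monom_altdef)
  have "f ^ ?p = [:poly f 0:] ^ ?p + (monom 1 1 * g) ^ ?p"
    by (subst g, subst freshmans_dream) simp_all
  also have "\<dots> = [:poly f 0 ^ ?p:] + monom 1 ?p * g ^ ?p"
    by (simp add: power_mult_distrib poly_const_pow monom_power)
  finally show ?thesis by simp
qed

text \<open>Compare parities of the order at \<open>a\<close>: for nonzero \<open>r\<close> and
  \<open>s\<close> it is odd on the left and even on the right.\<close>

lemma square_mult_odd_order_eq_imp_0: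
  fixes f r s :: "'a::field poly"
  assumes "odd (order a f)" "c \<noteq> 0" "f \<noteq> 0" and eq: "r\<^sup>2 * f = smult c (s\<^sup>2)"
  shows "r = 0 \<and> s = 0"
proof (rule ccontr)
  assume "\<not> (r = 0 \<and> s = 0)"
  then have "r \<noteq> 0" "s \<noteq> 0" using eq assms by auto
  then have "2 * order a r + order a f = 2 * order a s"
    using arg_cong[OF eq, of "order a"] assms
    by (simp add: order_mult order_smult power2_eq_square)
  then have "even (order a f)"
    by (metis even_add even_mult_iff even_numeral)
  then show False using assms by simp
qed

text \<open>
  The nonvanishing of the auxiliary polynomial: reducing modulo \<open>X\<^sup>p\<close> isolates the coefficients with
  index 0, where \<open>f\<^sup>p \<equiv> f(0)\<^sup>p\<close> turns the relation into an identity of polynomials of degree below \<open>p\<close>.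
\<close>

lemma X_power_adic_square_relation_imp_0:
  fixes f :: "'a::field_prime_char poly" and J :: nat
  assumes f0: "poly f 0 \<noteq> 0" and odd: "odd (order a f)"
    and b: "2 * b + degree f < CHAR('a)"
    and "\<And>j. j < J \<Longrightarrow> degree (r j) \<le> b" "\<And>j. j < J \<Longrightarrow> degree (s j) \<le> b"
    and "(\<Sum>j<J. monom 1 (CHAR('a) * j) * r j)\<^sup>2 * f
           = f ^ CHAR('a) * (\<Sum>j<J. monom 1 (CHAR('a) * j) * s j)\<^sup>2"
  shows "\<forall>j<J. r j = 0 \<and> s j = 0"
  using assms(4-6)
proof (induction J arbitrary: r s)
  case (Suc J)
  let ?p = "CHAR('a)"
  \<comment> \<open>\<open>X\<close> is the p-th power of the variable, so reducing modulo
    \<open>X\<close> leaves exactly the terms with index 0.\<close>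
  define X :: "'a poly" where "X = monom 1 ?p"
  define R where "R = (\<Sum>j<J. monom 1 (?p * j) * r (Suc j))"
  define S where "S = (\<Sum>j<J. monom 1 (?p * j) * s (Suc j))"
  define c where "c = poly f 0 ^ ?p"
  have split: "(\<Sum>j<Suc J. monom 1 (?p * j) * t j)
      = t 0 + X * (\<Sum>j<J. monom 1 (?p * j) * t (Suc j))" for t :: "nat \<Rightarrow> 'a poly"
    unfolding sum.lessThan_Suc_shift X_def
    by (simp add: sum_distrib_left mult.assoc[symmetric] mult_monom)
  have eq: "(r 0 + X * R)\<^sup>2 * f = f ^ ?p * (s 0 + X * S)\<^sup>2"
    using Suc.prems(3) unfolding split R_def S_def .
  obtain g where g: "f ^ ?p = [:c:] + X * g"
    using X_power_dvd_power_char[of f] unfolding X_def c_def dvd_def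
    by (metis add.commute diff_eq_eq)
  have "(r 0)\<^sup>2 * f - smult c ((s 0)\<^sup>2)
      = (r 0 + X * R)\<^sup>2 * f - f ^ ?p * (s 0 + X * S)\<^sup>2
        + X * (g * (s 0 + X * S)\<^sup>2 + [:c:] * (2 * s 0 * S + X * S\<^sup>2)
        - (2 * r 0 * R + X * R\<^sup>2) * f)"
    unfolding g by (simp add: power2_eq_square algebra_simps smult_add_right)
  also have "\<dots> = X * (g * (s 0 + X * S)\<^sup>2 + [:c:] * (2 * s 0 * S + X * S\<^sup>2)
        - (2 * r 0 * R + X * R\<^sup>2) * f)"
    using eq by simp
  finally have dvd: "X dvd (r 0)\<^sup>2 * f - smult c ((s 0)\<^sup>2)"
    by (metis dvd_triv_left)
  have "degree ((r 0)\<^sup>2 * f) \<le> 2 * b + degree f"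
    using degree_mult_le[of "(r 0)\<^sup>2" f] degree_mult_le[of "r 0" "r 0"] Suc.prems(1)[of 0]
    by (simp add: power2_eq_square)
  moreover have "degree (smult c ((s 0)\<^sup>2)) \<le> 2 * b + degree f"
    using degree_smult_le[of c "(s 0)\<^sup>2"] degree_mult_le[of "s 0" "s 0"] Suc.prems(2)[of 0]
    by (simp add: power2_eq_square)
  ultimately have "degree ((r 0)\<^sup>2 * f - smult c ((s 0)\<^sup>2)) < degree X"
    using degree_diff_le b unfolding X_def by (metis degree_monom_eq le_less_trans one_neq_zero)
  \<comment> \<open>A multiple of \<open>X\<close> whose degree is below that of \<open>X\<close>
    vanishes, so the congruence is an equality.\<close>
  with dvd have "(r 0)\<^sup>2 * f = smult c ((s 0)\<^sup>2)"
    by (metis dvd_imp_degree_le eq_iff_diff_eq_0 not_le)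
  then have 0: "r 0 = 0 \<and> s 0 = 0"
    by (rule square_mult_odd_order_eq_imp_0[OF odd, rotated 2]) (use f0 in \<open>auto simp: c_def\<close>)
  \<comment> \<open>Once the terms with index 0 are gone, cancelling the square of \<open>X\<close>
    shifts all indices by 1 and restores the shape of the induction hypothesis.\<close>
  have "X\<^sup>2 * (R\<^sup>2 * f) = X\<^sup>2 * (f ^ ?p * S\<^sup>2)"
    using eq 0 by (simp add: power_mult_distrib algebra_simps)
  then have "R\<^sup>2 * f = f ^ ?p * S\<^sup>2"
    by (simp add: X_def)
  then have "\<forall>j<J. r (Suc j) = 0 \<and> s (Suc j) = 0"
    unfolding R_def S_def by (intro Suc.IH) (use Suc.prems in auto)
  with 0 show ?case
    by (metis less_Suc_eq_0_disj)
qed simp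

text \<open>The core of Stepanov's method. The auxiliary polynomial f^l * (sum over j < J of X^(p j)
  (r_j + f^m s_j)), with r_j and s_j of degree at most \<open>b\<close>, has 2 J (b + 1) free
  coefficients. By \<open>count\<close> they can be chosen, not all zero, so that it vanishes to
  order \<open>l\<close> wherever f(x)^m = 1. It is not the zero polynomial, so its degree bounds
  the number of such points times \<open>l\<close>.\<close>

lemma card_power_eq_1_mult_le:
  fixes f :: "'a::finite_field poly"
  assumes card: "CARD('a) = CHAR('a)" "CARD('a) = 2 * m + 1"
    and f0: "poly f 0 \<noteq> 0" and odd: "odd (order a f)"
    and b: "2 * b + degree f < CARD('a)" and l: "l \<le> CARD('a)"
    and count: "l * (b + J + l * degree f) < 2 * J * (b + 1)"
  shows "card {x. poly f x ^ m = 1} * l \<le> degree f * l + b + degree f * m + CARD('a) * J"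
proof -
  let ?p = "CARD('a)"
  let ?d = "degree f"
  define U where "U = {..<J} \<times> {..b} \<times> (UNIV :: bool set)"
  define I where "I = {..<l} \<times> {..<b + J + l * ?d}"
  define R where "R = (\<lambda>(c :: nat \<times> nat \<times> bool \<Rightarrow> 'a) \<beta> j. \<Sum>i\<le>b. monom (c (j, i, \<beta>)) i)"
  \<comment> \<open>Up to a power of f, \<open>E c k\<close> agrees with the \<open>k\<close>-th
    derivative of the auxiliary polynomial at points with f(x)^m = 1, since x^p = x. Requiring
    \<open>E c k = 0\<close> as a polynomial costs one linear equation per coefficient, far fewer
    than a condition at every point.\<close>
  define E where "E = (\<lambda>c k. \<Sum>j<J. monom 1 j *
      (reduced_pderiv f l k (R c False j) + reduced_pderiv f (l + m) k (R c True j)))"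
  define L where "L = (\<lambda>(k, n) c. coeff (E c k) n)"
  have R_diff: "R (\<lambda>u. c u - c' u) \<beta> j = R c \<beta> j - R c' \<beta> j" for c c' \<beta> j
    by (simp add: R_def sum_subtractf[symmetric] diff_monom)
  have E_diff: "E (\<lambda>u. c u - c' u) k = E c k - E c' k" for c c' k
    unfolding E_def R_diff reduced_pderiv_diff
    by (simp add: sum_subtractf[symmetric] algebra_simps)
  have R_degree: "degree (R c \<beta> j) \<le> b" for c \<beta> j
    unfolding R_def by (intro degree_sum_le) (auto intro: order.trans[OF degree_monom_le])
  have E_degree: "degree (E c k) < b + J + l * ?d" if "k < l" "J > 0" for c k
  proof -
    have red: "degree (reduced_pderiv f n k (R c \<beta> j)) \<le> b + l * ?d" for n \<beta> j
    proof -
      have "degree (reduced_pderiv f n k (R c \<beta> j)) \<le> degree (R c \<beta> j) + k * ?d"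
        by (rule degree_reduced_pderiv)
      also have "\<dots> \<le> b + l * ?d"
        using R_degree[of c \<beta> j] that by (intro add_mono mult_right_mono) auto
      finally show ?thesis .
    qed
    have "degree (E c k) \<le> (J - 1) + (b + l * ?d)"
      unfolding E_def
    proof (intro degree_sum_le)
      fix j assume "j \<in> {..<J}"
      show "degree (monom 1 j * (reduced_pderiv f l k (R c False j)
          + reduced_pderiv f (l + m) k (R c True j))) \<le> (J - 1) + (b + l * ?d)"
        by (intro order.trans[OF degree_mult_le] add_mono degree_add_le red
            order.trans[OF degree_monom_le]) (use \<open>j \<in> {..<J}\<close> in auto)
    qed simp
    then show ?thesis using that by simp
  qed
  have J: "J > 0" using count by (cases J) auto
  obtain c where c: "\<exists>u\<in>U. c u \<noteq> 0" "\<And>i. i \<in> I \<Longrightarrow> L i c = 0"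
  proof (rule homogeneous_system_nontrivial[of I U L])
    show "card I < card U"
      using count by (simp add: I_def U_def card_cartesian_product algebra_simps)
    show "L i (\<lambda>u. c u - c' u) = L i c - L i c'" for i c c'
      by (cases i) (simp add: L_def E_diff)
  qed (auto simp: I_def U_def)
  define r where "r = R c False"
  define s where "s = R c True"
  have E0: "E c k = 0" if "k < l" for k
  proof (rule poly_eqI)
    fix n
    show "coeff (E c k) n = coeff 0 n"
    proof (cases "n < b + J + l * ?d")
      case True
      then show ?thesis using c(2)[of "(k, n)"] that by (simp add: I_def L_def)
    next
      case False
      then show ?thesis using E_degree[OF that J, of c] by (simp add: coeff_eq_0)
    qed
  qed
  define \<Psi> where "\<Psi> = (\<Sum>j<J. monom 1 (?p * j) * (f ^ l * r j + f ^ (l + m) * s j))"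
  have pd: "pderiv (monom 1 (?p * j)) = (0 :: 'a poly)" for j
    by (simp add: pderiv_monom card(1))
  have deriv: "(pderiv ^^ k) \<Psi> = (\<Sum>j<J. monom 1 (?p * j) *
      (f ^ (l - k) * reduced_pderiv f l k (r j)
       + f ^ (l + m - k) * reduced_pderiv f (l + m) k (s j)))" if "k \<le> l" for k
    unfolding \<Psi>_def using that
    by (simp add: higher_pderiv_sum higher_pderiv_mult_of_pderiv_eq_0[OF pd] higher_pderiv_add
        higher_pderiv_power_mult)
  have vanish: "[:- x, 1:] ^ l dvd \<Psi>" if x: "x \<in> {x. poly f x ^ m = 1}" for x
  proof (rule linear_power_dvd_of_higher_pderiv)
    fix k assume k: "k < l"
    have "poly ((pderiv ^^ k) \<Psi>) x = (\<Sum>j<J. x ^ j * (poly f x ^ (l - k) *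
        (poly (reduced_pderiv f l k (r j)) x + poly (reduced_pderiv f (l + m) k (s j)) x)))"
    proof -
      have "x ^ (?p * j) = x ^ j" for j
        by (simp add: power_mult finite_field_power_card_eq_same)
      moreover have "poly f x ^ (l + m - k) = poly f x ^ (l - k)"
      proof -
        have "l + m - k = (l - k) + m" using k by simp
        then show ?thesis using x by (simp add: power_add)
      qed
      ultimately show ?thesis
        using k by (simp add: deriv poly_sum poly_monom algebra_simps)
    qed
    also have "\<dots> = poly f x ^ (l - k) * poly (E c k) x"
      by (simp add: E_def poly_sum poly_monom sum_distrib_left r_def s_def algebra_simps)
    finally show "poly ((pderiv ^^ k) \<Psi>) x = 0"
      using E0[OF k] by simp
  qed (use l card in simp)
  have nz: "\<Psi> \<noteq> 0"
  proof
    assume "\<Psi> = 0"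
    define RR where "RR = (\<Sum>j<J. monom 1 (?p * j) * r j)"
    define SS where "SS = (\<Sum>j<J. monom 1 (?p * j) * s j)"
    have "\<Psi> = f ^ l * (RR + f ^ m * SS)"
      by (simp add: \<Psi>_def RR_def SS_def sum_distrib_left sum.distrib[symmetric] algebra_simps power_add)
    moreover have "f \<noteq> 0" using f0 by auto
    ultimately have "RR = - (f ^ m * SS)"
      using \<open>\<Psi> = 0\<close> by (simp add: add_eq_0_iff2)
    \<comment> \<open>Squaring and multiplying by \<open>f\<close> produces the exponent 2 m + 1 =
      p, hence a relation between p-adic expansions in the variable.\<close>
    then have "RR\<^sup>2 * f = f ^ CHAR('a) * SS\<^sup>2"
      unfolding card(1)[symmetric] card(2)
      by (simp add: power_mult_distrib power_add power_mult[symmetric] mult.commute algebra_simps)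
    then have "\<forall>j<J. r j = 0 \<and> s j = 0"
      unfolding RR_def SS_def
      by (intro X_power_adic_square_relation_imp_0[OF f0 odd, where b = b])
        (use b card R_degree in \<open>auto simp: r_def s_def\<close>)
    moreover obtain j i \<beta> where u: "j < J" "i \<le> b" "c (j, i, \<beta>) \<noteq> 0"
      using c(1) by (auto simp: U_def)
    moreover have "coeff (R c \<beta> j) i = c (j, i, \<beta>)"
      using u(2) by (simp add: R_def coeff_sum)
    moreover have "R c \<beta> j = (if \<beta> then s j else r j)"
      by (simp add: r_def s_def)
    ultimately show False by (cases \<beta>) auto
  qed
  have "card {x. poly f x ^ m = 1} * l \<le> degree \<Psi>"
    by (rule card_mult_le_degree[OF nz vanish])
  also have "degree \<Psi> \<le> ?p * J + ((l + m) * ?d + b)"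
    unfolding \<Psi>_def
  proof (intro degree_sum_le)
    fix j assume j: "j \<in> {..<J}"
    have pw: "degree (f ^ n) \<le> (l + m) * ?d" if "n \<le> l + m" for n
      using degree_power_le[of f n] that
      by (metis dual_order.trans mult.commute mult_le_mono1)
    show "degree (monom 1 (?p * j) * (f ^ l * r j + f ^ (l + m) * s j)) \<le> ?p * J + ((l + m) * ?d + b)"
      by (intro order.trans[OF degree_mult_le] add_mono degree_add_le pw
            order.trans[OF degree_monom_le]) (use j in \<open>auto simp: r_def s_def R_degree\<close>)
  qed simp
  finally show ?thesis by (simp add: algebra_simps)
qed

section \<open>Sums of the quadratic character over products of linear factors\<close>

text \<open>Take l = 2 h of size about sqrt(p), \<open>b\<close> about p/2, and \<open>J\<close>
  exceeding l/2 only by 2 (d + 2). After division by l the dominant term p J / l is p/2 plus O((d +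
  1) sqrt(p)).\<close>

lemma card_power_eq_1_le:
  fixes f :: "'a::finite_field poly"
  assumes card: "CARD('a) = CHAR('a)" "CARD('a) = 2 * m + 1"
    and f0: "poly f 0 \<noteq> 0" and odd: "odd (order a f)"
    and large: "64 * (degree f + 3)\<^sup>2 \<le> CARD('a)"
  shows "real (card {x. poly f x ^ m = 1})
           \<le> real CARD('a) / 2 + (6 * real (degree f) + 9) * sqrt (real CARD('a))"
proof -
  define p where "p = CARD('a)"
  define d where "d = degree f"
  define h where "h = nat \<lfloor>sqrt (real p) / 2\<rfloor>"
  define b where "b = (p - 1 - d) div 2"
  define J where "J = h + 2 * (d + 2)"
  have sq: "sqrt (real p) \<ge> 8 * (real d + 3)"
  proof (rule real_le_rsqrt)
    have "real (64 * (d + 3)\<^sup>2) \<le> real p"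
      using large unfolding p_def d_def of_nat_le_iff .
    then show "(8 * (real d + 3))\<^sup>2 \<le> real p"
      by (simp add: power2_eq_square algebra_simps)
  qed
  have h: "real h \<le> sqrt (real p) / 2" "real h > sqrt (real p) / 2 - 1"
    using of_nat_floor[of "sqrt (real p) / 2"] floor_correct[of "sqrt (real p) / 2"]
    unfolding h_def by (simp, linarith)
  have "2 * d + 2 \<le> 64 * (d + 3)\<^sup>2"
    by (simp add: power2_eq_square algebra_simps)
  then have pd: "2 * d + 2 \<le> p"
    using large unfolding p_def[symmetric] d_def[symmetric] by linarith
  have hJ: "J \<le> 2 * h"
  proof -
    have "real h \<ge> 2 * (real d + 2)" using h sq of_nat_0_le_iff[of d, where ?'a = real] by argo
    then have "real (2 * (d + 2)) \<le> real h" by simp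
    then have "2 * (d + 2) \<le> h" unfolding of_nat_le_iff .
    then show ?thesis unfolding J_def by simp
  qed
  have "(2 * real h)\<^sup>2 \<le> (sqrt (real p))\<^sup>2"
    using h by (intro power_mono) auto
  then have hp: "real (2 * h * (2 * h)) \<le> real p"
    by (simp add: power2_eq_square)
  then have hp': "2 * h * (2 * h) \<le> p" unfolding of_nat_le_iff .
  have hpos: "h > 0" using hJ unfolding J_def by simp
  have "card {x. poly f x ^ m = 1} * (2 * h) \<le> degree f * (2 * h) + b + degree f * m + CARD('a) * J"
  proof (rule card_power_eq_1_mult_le[OF card f0 odd])
    show "2 * b + degree f < CARD('a)"
      using pd unfolding b_def p_def d_def by linarith
    have "2 * h \<le> 2 * h * (2 * h)" using hpos by simp
    then show "2 * h \<le> CARD('a)" using hp' unfolding p_def by linarith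
    have b1: "2 * (b + 1) \<ge> p - d" unfolding b_def by presburger
    \<comment> \<open>The quadratic terms are at most (2 h)^2 (d + 1) \<le> p (d + 1). The surplus 2
      (d + 2) in \<open>J\<close> pays for them, because 2 (b + 1) is at least p - d.\<close>
    have "2 * h * (b + J + 2 * h * d) \<le> 2 * h * b + (2 * h * (2 * h)) * (d + 1)"
      using mult_left_mono[OF hJ, of "2 * h"] by (simp add: algebra_simps)
    also have "\<dots> \<le> 2 * h * b + p * (d + 1)"
      using mult_right_mono[OF hp', of "d + 1"] by simp
    also have "\<dots> < 2 * h * (b + 1) + (2 * (d + 2)) * (2 * (b + 1))"
    proof -
      have "p * (d + 1) \<le> (2 * (p - d)) * (d + 2)"
        using pd by (intro mult_mono) auto
      also have "\<dots> = 2 * (d + 2) * (p - d)" by simp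
      also have "\<dots> \<le> 2 * (d + 2) * (2 * (b + 1))"
        using b1 by (intro mult_left_mono) auto
      finally show ?thesis using hpos by simp
    qed
    also have "\<dots> = 2 * J * (b + 1)"
      by (simp add: J_def algebra_simps)
    finally show "2 * h * (b + J + 2 * h * degree f) < 2 * J * (b + 1)"
      unfolding d_def .
  qed
  then have "card {x. poly f x ^ m = 1} * (2 * h) \<le> d * (2 * h) + b + d * m + p * J"
    unfolding d_def p_def .
  then have "real (card {x. poly f x ^ m = 1} * (2 * h)) \<le> real (d * (2 * h) + b + d * m + p * J)"
    unfolding of_nat_le_iff .
  moreover have "real b \<le> real p / 2"
    unfolding b_def by linarith
  moreover have "real d * real m \<le> real d * (real p / 2)"
    using card(2) unfolding p_def by (intro mult_left_mono) auto
  ultimately have "real (card {x. poly f x ^ m = 1}) * (2 * real h)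
      \<le> (real d + real p / 2) * (2 * real h) + real p * (5 / 2 * real d + 9 / 2)"
    by (simp add: J_def algebra_simps)
  \<comment> \<open>Here 2 h \<ge> sqrt(p) / 2, since rounding down costs \<open>h\<close> less than
    1.\<close>
  also have "real p * (5 / 2 * real d + 9 / 2) \<le> sqrt (real p) * (5 * real d + 9) * (2 * real h)"
  proof -
    have "s * s * (5 / 2 * real d + 9 / 2) = s * (5 * real d + 9) * (s / 2)" for s
      by (simp add: algebra_simps)
    from this[of "sqrt (real p)"]
    have "real p * (5 / 2 * real d + 9 / 2) = sqrt (real p) * (5 * real d + 9) * (sqrt (real p) / 2)"
      unfolding real_sqrt_mult_self by simp
    also have "\<dots> \<le> sqrt (real p) * (5 * real d + 9) * (2 * real h)"
      using h sq by (intro mult_left_mono) auto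
    finally show ?thesis .
  qed
  finally have "real (card {x. poly f x ^ m = 1}) * (2 * real h)
      \<le> (real d + real p / 2 + sqrt (real p) * (5 * real d + 9)) * (2 * real h)"
    by (simp add: algebra_simps)
  then have "real (card {x. poly f x ^ m = 1})
      \<le> real d + real p / 2 + sqrt (real p) * (5 * real d + 9)"
    using hpos by simp
  moreover have "real d \<le> real d * sqrt (real p)"
    using pd by (simp add: mult_le_cancel_left1)
  ultimately show ?thesis
    unfolding p_def d_def by (simp add: algebra_simps)
qed

text \<open>Phrased as a predicate of \<open>p\<close> alone so that it can be carried from the
  cardinality of a type to every prime. The index \<open>k\<close> provides a simple root of the
  product, and the condition on all \<open>z j\<close> keeps 0 from being a root. The estimate is
  one-sided because it will bound a second moment from above.\<close>

definition linear_product_sum_bound :: "nat \<Rightarrow> bool" where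
  "linear_product_sum_bound p \<longleftrightarrow> (\<forall>d z k. k < d \<longrightarrow> (\<forall>j<d. \<not> int p dvd z j) \<longrightarrow>
     (\<forall>j<d. j \<noteq> k \<longrightarrow> \<not> [z j = z k] (mod int p)) \<longrightarrow> 64 * (d + 3)\<^sup>2 \<le> p \<longrightarrow>
     real_of_int (\<Sum>x\<in>{0..<int p}. Legendre (\<Prod>j<d. x + z j) (int p))
       \<le> (13 * real d + 18) * sqrt (real p))"

text \<open>Euler's criterion turns Legendre symbol 1 into f(x)^m = 1, whose solutions Stepanov's
  method counts. The root given by \<open>z k\<close> has order 1, which is odd.\<close>

lemma linear_product_sum_bound_card:
  "linear_product_sum_bound CARD('a::prime_card)"
  unfolding linear_product_sum_bound_def
proof (intro allI impI)
  fix d k :: nat and z :: "nat \<Rightarrow> int"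
  define p where "p = CARD('a)"
  assume k: "k < d" and nz: "\<forall>j<d. \<not> int CARD('a) dvd z j"
    and simple: "\<forall>j<d. j \<noteq> k \<longrightarrow> \<not> [z j = z k] (mod int CARD('a))"
    and large: "64 * (d + 3)\<^sup>2 \<le> CARD('a)"
  have p: "prime p" using prime_card[where ?'a = 'a] by (simp add: p_def)
  have "64 * (d + 3)\<^sup>2 \<ge> 64" by simp
  then have p2: "p > 2" using large unfolding p_def by linarith
  then have "odd p" using p prime_odd_nat by auto
  then obtain m where m: "p = 2 * m + 1" by (elim oddE)
  define F where "F = (\<lambda>x. \<Prod>j<d. x + z j)"
  define f :: "'a mod_ring poly" where "f = (\<Prod>j<d. [:of_int (z j), 1:])"
  have deg: "degree f = d"
    unfolding f_def by (subst degree_prod_sum_eq) auto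
  have f_nz: "f \<noteq> 0" unfolding f_def by auto
  have eval: "poly f (of_int x) = of_int (F x)" for x
    by (simp add: f_def F_def poly_prod add.commute)
  have of_int_eq: "(of_int x :: 'a mod_ring) = of_int y \<longleftrightarrow> [x = y] (mod int p)" for x y
    by (simp add: of_int_eq_iff_cong_CHAR p_def)
  have of_int_0: "(of_int x :: 'a mod_ring) = 0 \<longleftrightarrow> int p dvd x" for x
    using of_int_eq[of x 0] by (simp add: cong_0_iff)
  have inj: "inj_on (of_int :: int \<Rightarrow> 'a mod_ring) {0..<int p}"
    by (auto simp: inj_on_def of_int_eq cong_def)
  have "poly f 0 \<noteq> 0"
    using nz by (auto simp: f_def poly_prod of_int_0 p_def)
  moreover have "order (- of_int (z k)) f = 1"
  proof -
    have "f = [:of_int (z k), 1:] * (\<Prod>j\<in>{..<d} - {k}. [:of_int (z j), 1:])"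
      unfolding f_def using k by (subst prod.remove[of _ k]) auto
    moreover have "order (- of_int (z k)) (\<Prod>j\<in>{..<d} - {k}. [:of_int (z j), 1::'a mod_ring:]) = 0"
      using simple by (intro order_0I) (auto simp: poly_prod of_int_eq p_def)
    moreover have "order (- of_int (z k)) [:of_int (z k), 1::'a mod_ring:] = 1"
      using order_power_n_n[of "- of_int (z k) :: 'a mod_ring" 1] by simp
    ultimately show ?thesis
      using f_nz by (metis add.right_neutral order_mult)
  qed
  ultimately have bound: "real (card {x. poly f x ^ m = 1})
      \<le> real p / 2 + (6 * real d + 9) * sqrt (real p)"
    using card_power_eq_1_le[of m f "- of_int (z k)"] large m deg by (simp add: p_def)
  define A where "A = (\<lambda>e. {x \<in> {0..<int p}. Legendre (F x) (int p) = e})"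
  have fin: "finite (A e)" for e
    unfolding A_def by (rule finite_subset[of _ "{0..<int p}"]) auto
  have split: "{0..<int p} = A 0 \<union> A 1 \<union> A (- 1)"
    by (auto simp: A_def Legendre_def)
  have disj: "A 0 \<inter> A 1 = {}" "(A 0 \<union> A 1) \<inter> A (- 1) = {}"
    by (auto simp: A_def)
  have "card {0..<int p} = card (A 0) + card (A 1) + card (A (- 1))"
    unfolding split using fin disj by (simp add: card_Un_disjoint)
  then have total: "p = card (A 0) + card (A 1) + card (A (- 1))" by simp
  have "card (A 1) \<le> card {x. poly f x ^ m = 1}"
  proof (rule card_inj_on_le)
    show "inj_on (of_int :: int \<Rightarrow> 'a mod_ring) (A 1)"
      using inj by (rule inj_on_subset) (auto simp: A_def)
    show "of_int ` A 1 \<subseteq> {x. poly f x ^ m = 1}"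
    proof safe
      fix x assume "x \<in> A 1"
      then have "[1 = F x ^ m] (mod int p)"
        using euler_criterion[OF p p2, of "F x"] m by (simp add: A_def)
      then show "poly f (of_int x) ^ m = 1"
        using of_int_eq[of 1 "F x ^ m"] by (simp add: eval)
    qed
  qed simp
  then have A1: "real (card (A 1)) \<le> real p / 2 + (6 * real d + 9) * sqrt (real p)"
    using bound by linarith
  have "card (A 0) \<le> card {x. poly f x = 0}"
  proof (rule card_inj_on_le)
    show "inj_on (of_int :: int \<Rightarrow> 'a mod_ring) (A 0)"
      using inj by (rule inj_on_subset) (auto simp: A_def)
    show "of_int ` A 0 \<subseteq> {x. poly f x = 0}"
      by (auto simp: A_def Legendre_def eval of_int_0 cong_0_iff split: if_splits)
  qed simp
  also have "\<dots> \<le> d"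
    using card_poly_roots_bound[OF f_nz] deg by simp
  finally have A0: "card (A 0) \<le> d" .
  have "(\<Sum>x\<in>{0..<int p}. Legendre (F x) (int p))
      = (\<Sum>x\<in>A 0. Legendre (F x) (int p)) + (\<Sum>x\<in>A 1. Legendre (F x) (int p))
        + (\<Sum>x\<in>A (- 1). Legendre (F x) (int p))"
    unfolding split using fin disj by (simp add: sum.union_disjoint)
  also have "\<dots> = (\<Sum>x\<in>A 0. 0) + (\<Sum>x\<in>A 1. 1) + (\<Sum>x\<in>A (- 1). - 1)"
    by (intro arg_cong2[of _ _ _ _ "(+)"] sum.cong) (auto simp: A_def)
  also have "\<dots> = int (card (A 1)) - int (card (A (- 1)))"
    by simp
  \<comment> \<open>The number of values -1 is eliminated through the total \<open>p\<close>, so an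
    upper bound for the number of values 1 suffices.\<close>
  finally have "real_of_int (\<Sum>x\<in>{0..<int p}. Legendre (F x) (int p))
      = 2 * real (card (A 1)) + real (card (A 0)) - real p"
    using total by simp
  also have "\<dots> \<le> (12 * real d + 18) * sqrt (real p) + real d * 1"
    using A1 A0 by (simp add: algebra_simps)
  also have "\<dots> \<le> (12 * real d + 18) * sqrt (real p) + real d * sqrt (real p)"
    using p2 by (intro add_left_mono mult_left_mono) auto
  finally show "real_of_int (\<Sum>x\<in>{0..<int CARD('a)}. Legendre (\<Prod>j<d. x + z j) (int CARD('a)))
       \<le> (13 * real d + 18) * sqrt (real CARD('a))"
    by (simp add: F_def p_def algebra_simps)
qed

text \<open>
  The estimate is proved in a field type, and types cannot depend on \<open>p\<close>. It is transferred to all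
  primes through a single type whose cardinality is a prime violating it, if there is one at all.
\<close>

definition critical_prime :: nat where
  "critical_prime = (SOME p. prime p \<and>
     (linear_product_sum_bound p \<longrightarrow> (\<forall>q. prime q \<longrightarrow> linear_product_sum_bound q)))"

text \<open>An instance of the drinker paradox: choose a prime violating the bound if there is one,
  and otherwise any prime.\<close>

lemma critical_prime:
  "prime critical_prime"
  "linear_product_sum_bound critical_prime \<Longrightarrow> prime q \<Longrightarrow> linear_product_sum_bound q"
proof -
  have "\<exists>p::nat. prime p \<and>
     (linear_product_sum_bound p \<longrightarrow> (\<forall>q. prime q \<longrightarrow> linear_product_sum_bound q))"
    using two_is_prime_nat by blast
  from someI_ex[OF this] show "prime critical_prime"
    "linear_product_sum_bound critical_prime \<Longrightarrow> prime q \<Longrightarrow> linear_product_sum_bound q"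
    unfolding critical_prime_def by blast+
qed

typedef critical_type = "{..<critical_prime}"
  using critical_prime(1) prime_gt_0_nat by auto

lemma card_critical_type: "CARD(critical_type) = critical_prime"
  by (simp add: type_definition.card[OF type_definition_critical_type])

instance critical_type :: prime_card
  by standard (simp add: card_critical_type critical_prime(1))

lemma linear_product_sum_bound_prime:
  "prime p \<Longrightarrow> linear_product_sum_bound p"
  using linear_product_sum_bound_card[where ?'a = critical_type] critical_prime(2)
  unfolding card_critical_type by blast

section \<open>Runs on which the quadratic character is constant\<close>

text \<open>By Euler's criterion both sides are congruent modulo \<open>p\<close>. They differ by at
  most 2, which is less than \<open>p\<close>.\<close>

lemma Legendre_mult:
  assumes p: "prime p" "2 < p"
  shows "Legendre (a * b) (int p) = Legendre a (int p) * Legendre b (int p)"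
proof -
  have "[Legendre (a * b) (int p) = (a * b) ^ ((p - 1) div 2)] (mod int p)"
    by (rule euler_criterion[OF p])
  also have "(a * b) ^ ((p - 1) div 2) = a ^ ((p - 1) div 2) * b ^ ((p - 1) div 2)"
    by (simp add: power_mult_distrib)
  also have "[\<dots> = Legendre a (int p) * Legendre b (int p)] (mod int p)"
    by (intro cong_mult cong_sym[OF euler_criterion[OF p]])
  finally have "int p dvd Legendre (a * b) (int p) - Legendre a (int p) * Legendre b (int p)"
    by (simp add: cong_iff_dvd_diff)
  moreover have "\<bar>Legendre (a * b) (int p) - Legendre a (int p) * Legendre b (int p)\<bar> \<le> 2"
    by (auto simp: Legendre_def)
  ultimately show ?thesis
    using p(2) zdvd_not_zless[of "\<bar>Legendre (a * b) (int p) - Legendre a (int p) * Legendre b (int p)\<bar>" "int p"]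
    by fastforce
qed

lemma Legendre_cong:
  assumes "[a = b] (mod p)"
  shows "Legendre a p = Legendre b p"
proof -
  have "[c = a] (mod p) \<longleftrightarrow> [c = b] (mod p)" and "[a = c] (mod p) \<longleftrightarrow> [b = c] (mod p)" for c
    using assms by (simp_all add: cong_def)
  then show ?thesis by (simp add: Legendre_def QuadRes_def)
qed

lemma Legendre_1:
  assumes "2 < p"
  shows "Legendre 1 (int p) = 1"
proof -
  have "\<not> [1 = 0] (mod int p)"
    using assms by (simp add: cong_0_iff)
  moreover have "QuadRes (int p) 1"
    unfolding QuadRes_def by (intro exI[of _ 1]) simp
  ultimately show ?thesis by (simp add: Legendre_def)
qed

lemma Legendre_prod:
  assumes "prime p" "2 < p"
  shows "Legendre (\<Prod>i\<in>A. g i) (int p) = (\<Prod>i\<in>A. Legendre (g i) (int p))"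
  by (induction A rule: infinite_finite_induct)
    (simp_all add: Legendre_mult[OF assms] Legendre_1[OF assms(2)])

lemma Legendre_eq_1_iff: "prime p \<Longrightarrow> Legendre a (int p) = 1 \<longleftrightarrow> quadratic_residue p a"
  by (auto simp: Legendre_def quadratic_residue_def cong_0_iff coprime_commute
      dest: prime_imp_coprime_int[of "int p" a, simplified] not_coprimeI)

definition character_run :: "nat \<Rightarrow> int \<Rightarrow> int set" where
  "character_run p V = {x \<in> {0..<int p}. \<exists>\<sigma>\<in>{1, - 1}. \<forall>v\<in>{1..V}. Legendre (x + v) (int p) \<in> {0, \<sigma>}}"

lemma finite_character_run [simp]: "finite (character_run p V)"
  unfolding character_run_def by (rule finite_subset[of _ "{0..<int p}"]) auto

text \<open>Blocks are disjoint, so only \<open>v k\<close> and \<open>w k\<close> lie in block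
  \<open>k\<close>. As they differ, \<open>v k\<close> differs from all the other 2 s - 1 shifts and
  yields a simple root. All shifts lie strictly between 0 and \<open>p\<close>, so equality and
  congruence coincide.\<close>

lemma block_pair_sum_le:
  fixes v w :: "nat \<Rightarrow> int"
  assumes p: "prime p" "2 < p" and large: "s * W < p" "64 * (2 * s + 3)\<^sup>2 \<le> p"
    and v: "\<And>i. i < s \<Longrightarrow> v i \<in> {int (i * W) + 1..int (Suc i * W)}"
    and w: "\<And>i. i < s \<Longrightarrow> w i \<in> {int (i * W) + 1..int (Suc i * W)}"
    and k: "k < s" "v k \<noteq> w k"
  shows "real_of_int (\<Sum>x\<in>{0..<int p}. Legendre ((\<Prod>i<s. x + v i) * (\<Prod>i<s. x + w i)) (int p))
    \<le> (26 * real s + 18) * sqrt (real p)"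
proof -
  \<comment> \<open>The two tuples are concatenated, with \<open>v\<close> in front, so that the
    distinguished index \<open>k\<close> below \<open>s\<close> refers to
    \<open>v k\<close>.\<close>
  define z where "z = (\<lambda>j. if j < s then v j else w (j - s))"
  have in_block: "z j \<in> {int ((if j < s then j else j - s) * W) + 1..
      int (Suc (if j < s then j else j - s) * W)}" if "j < 2 * s" for j
    using v[of j] w[of "j - s"] that by (auto simp: z_def)
  have range: "z j \<in> {1..<int p}" if "j < 2 * s" for j
  proof -
    define i where "i = (if j < s then j else j - s)"
    have "i < s" using that by (auto simp: i_def)
    then have "Suc i * W \<le> s * W" by (intro mult_right_mono) auto
    then have "int (Suc i * W) < int p"
      using large(1) by linarith
    moreover have "0 \<le> int (i * W)" by simp
    ultimately show ?thesis
      using in_block[OF that] unfolding i_def[symmetric] atLeastAtMost_iff atLeastLessThan_iff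
      by linarith
  qed
  have block_eq: "i = i'" if "a \<in> {int (i * W) + 1..int (Suc i * W)}"
    "a \<in> {int (i' * W) + 1..int (Suc i' * W)}" for a i i'
  proof (rule ccontr)
    assume "i \<noteq> i'"
    then consider "Suc i \<le> i'" | "Suc i' \<le> i" by linarith
    then show False
    proof cases
      case 1
      then have "int (Suc i * W) \<le> int (i' * W)" by (intro of_nat_mono mult_right_mono) auto
      then show False using that by simp
    next
      case 2
      then have "int (Suc i' * W) \<le> int (i * W)" by (intro of_nat_mono mult_right_mono) auto
      then show False using that by simp
    qed
  qed
  have "real_of_int (\<Sum>x\<in>{0..<int p}. Legendre (\<Prod>j<2*s. x + z j) (int p))
      \<le> (13 * real (2 * s) + 18) * sqrt (real p)"
  proof (rule linear_product_sum_bound_prime[OF p(1), unfolded linear_product_sum_bound_def, rule_format])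
    show "k < 2 * s" using k by simp
    show "\<not> int p dvd z j" if "j < 2 * s" for j
      using range[OF that] zdvd_not_zless by auto
    show "\<not> [z j = z k] (mod int p)" if "j < 2 * s" "j \<noteq> k" for j
    proof
      assume "[z j = z k] (mod int p)"
      then have eq: "z j = z k"
        using range[OF that(1)] range[of k] k by (simp add: cong_def)
      have "(if j < s then j else j - s) = k"
        using block_eq[of "z k" "if j < s then j else j - s" k] in_block[OF that(1)] in_block[of k] eq k(1)
        by simp
      then show False using that k eq by (auto simp: z_def split: if_splits)
    qed
  qed (use large in simp)
  moreover have "(\<Prod>j<2*s. x + z j) = (\<Prod>i<s. x + v i) * (\<Prod>i<s. x + w i)" for x
  proof -
    have "{..<2*s} = {..<s} \<union> {s..<2*s}" by auto
    then have "(\<Prod>j<2*s. x + z j) = (\<Prod>j<s. x + z j) * (\<Prod>j=s..<2*s. x + z j)"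
      by (simp add: prod.union_disjoint ivl_disj_int)
    also have "(\<Prod>j=s..<2*s. x + z j) = (\<Prod>i<s. x + z (i + s))"
      using prod.shift_bounds_nat_ivl[of "\<lambda>j. x + z j" 0 s s]
      by (simp add: mult_2 atLeast0LessThan)
    finally show ?thesis by (simp add: z_def)
  qed
  ultimately show ?thesis by simp
qed

text \<open>A second moment argument. On a run without zeros the product \<open>G\<close> of the
  block sums has square W^(2 s). In the expansion of the full second moment the W^s diagonal pairs
  contribute at most \<open>p\<close> each, and every other pair at most \<open>B\<close>. Runs
  containing a zero are counted separately, which gives the term \<open>s * W\<close>.\<close>

lemma card_character_run_le:
  assumes p: "prime p" "2 < p" and W: "0 < W" and large: "s * W < p" "64 * (2 * s + 3)\<^sup>2 \<le> p"
  shows "real (card (character_run p (int (s * W))))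
    \<le> real (s * W) + real p / real W ^ s + (26 * real s + 18) * sqrt (real p)"
proof -
  define \<chi> where "\<chi> = (\<lambda>a. Legendre a (int p))"
  define V where "V = (\<lambda>i. {int (i * W) + 1..int (Suc i * W)})"
  define B where "B = (26 * real s + 18) * sqrt (real p)"
  define X where "X = character_run p (int (s * W))"
  define Z where "Z = {x \<in> X. \<exists>v\<in>{1..int (s * W)}. int p dvd x + v}"
  have finX: "finite X" by (simp add: X_def)
  have V_sub: "V i \<subseteq> {1..int (s * W)}" if "i < s" for i
  proof -
    have "int (Suc i * W) \<le> int (s * W)"
      using that by (intro of_nat_mono mult_right_mono) auto
    then show ?thesis unfolding V_def by auto
  qed
  have card_V: "card (V i) = W" for i by (simp add: V_def)
  \<comment> \<open>A multiple of \<open>p\<close> strictly between 0 and 2 p is \<open>p\<close>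
    itself, so \<open>x\<close> is determined by the shift at which the zero occurs.\<close>
  have "Z \<subseteq> (\<lambda>v. int p - v) ` {1..int (s * W)}"
  proof
    fix x assume "x \<in> Z"
    then obtain v where v: "v \<in> {1..int (s * W)}" "int p dvd x + v" "x \<in> {0..<int p}"
      by (auto simp: Z_def X_def character_run_def)
    then obtain t where t: "x + v = int p * t" by (auto simp: dvd_def)
    have "int (s * W) < int p" using large(1) by linarith
    then have "0 < x + v" "x + v < int p * 2"
      using v(1,3) unfolding atLeastAtMost_iff atLeastLessThan_iff by linarith+
    then have "0 < int p * t" "int p * t < int p * 2" unfolding t .
    then have "t = 1" using p by (auto simp: zero_less_mult_iff)
    then show "x \<in> (\<lambda>v. int p - v) ` {1..int (s * W)}"
      using v t by (intro image_eqI[of _ _ v]) auto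
  qed
  then have "card Z \<le> card {1..int (s * W)}"
    by (rule surj_card_le[rotated]) simp
  then have card_Z: "card Z \<le> s * W" by (simp del: of_nat_mult)
  define G where "G = (\<lambda>x. \<Prod>i<s. \<Sum>v\<in>V i. \<chi> (x + v))"
  have G_sq: "(G x)\<^sup>2 = int (W ^ (2 * s))" if x: "x \<in> X - Z" for x
  proof -
    obtain \<sigma> where \<sigma>: "\<sigma> \<in> {1, - 1}" "\<forall>v\<in>{1..int (s * W)}. \<chi> (x + v) \<in> {0, \<sigma>}"
      using x by (auto simp: X_def character_run_def \<chi>_def)
    have "\<chi> (x + v) = \<sigma>" if "v \<in> {1..int (s * W)}" for v
    proof -
      have "\<not> int p dvd x + v" using x that by (auto simp: Z_def)
      then have "\<chi> (x + v) \<noteq> 0" by (auto simp: \<chi>_def Legendre_def cong_0_iff)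
      then show ?thesis using \<sigma>(2) that by blast
    qed
    then have "(\<Sum>v\<in>V i. \<chi> (x + v)) = (\<Sum>v\<in>V i. \<sigma>)" if "i < s" for i
      using V_sub[OF that] by (intro sum.cong) auto
    then have "G x = (\<Prod>i<s. int W * \<sigma>)"
      unfolding G_def by (intro prod.cong) (auto simp: card_V)
    then have "(G x)\<^sup>2 = (int W ^ s)\<^sup>2 * (\<sigma>\<^sup>2) ^ s"
      by (simp add: power_mult_distrib power_mult[symmetric] mult.commute)
    also have "\<dots> = int (W ^ (2 * s))"
      using \<sigma>(1) by (auto simp: power_mult[symmetric] mult.commute)
    finally show ?thesis .
  qed
  define T where "T = PiE {..<s} V"
  have finT: "finite T" unfolding T_def V_def by (intro finite_PiE) auto
  have card_T: "card T = W ^ s"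
    unfolding T_def by (subst card_PiE) (auto simp: card_V)
  define P where "P = (\<lambda>v w. \<Sum>x\<in>{0..<int p}. \<chi> ((\<Prod>i<s. x + v i) * (\<Prod>i<s. x + w i)))"
  have G_expand: "G x = (\<Sum>v\<in>T. \<chi> (\<Prod>i<s. x + v i))" for x
    unfolding G_def T_def \<chi>_def Legendre_prod[OF p]
    by (subst prod_sum_PiE) (auto simp: V_def)
  have "(\<Sum>x\<in>{0..<int p}. (G x)\<^sup>2) = (\<Sum>x\<in>{0..<int p}. \<Sum>v\<in>T. \<Sum>w\<in>T.
      \<chi> ((\<Prod>i<s. x + v i) * (\<Prod>i<s. x + w i)))"
    by (simp add: G_expand power2_eq_square sum_product \<chi>_def Legendre_mult[OF p])
  also have "\<dots> = (\<Sum>v\<in>T. \<Sum>x\<in>{0..<int p}. \<Sum>w\<in>T. \<chi> ((\<Prod>i<s. x + v i) * (\<Prod>i<s. x + w i)))"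
    by (rule sum.swap)
  also have "\<dots> = (\<Sum>v\<in>T. \<Sum>w\<in>T. P v w)"
    unfolding P_def by (intro sum.cong refl sum.swap)
  finally have sum_G: "(\<Sum>x\<in>{0..<int p}. (G x)\<^sup>2) = (\<Sum>v\<in>T. \<Sum>w\<in>T. P v w)" .
  have B0: "B \<ge> 0" by (simp add: B_def)
  have P_le: "real_of_int (P v w) \<le> B + (if v = w then real p else 0)" if vw: "v \<in> T" "w \<in> T" for v w
  proof (cases "v = w")
    case True
    have "P v w \<le> (\<Sum>x\<in>{0..<int p}. 1)"
      unfolding P_def \<chi>_def by (intro sum_mono) (auto simp: Legendre_def)
    then have "P v w \<le> int p" by simp
    then show ?thesis using True B0 by simp
  next
    case False
    then obtain k where "k < s" "v k \<noteq> w k"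
      using vw unfolding T_def by (metis PiE_ext lessThan_iff)
    then have "real_of_int (P v w) \<le> B"
      unfolding P_def \<chi>_def B_def
      by (intro block_pair_sum_le[OF p large]) (use vw in \<open>auto simp: T_def V_def PiE_def Pi_def\<close>)
    then show ?thesis using False by simp
  qed
  have "real (card (X - Z)) * real W ^ (2 * s) = real_of_int (\<Sum>x\<in>X - Z. (G x)\<^sup>2)"
    by (simp add: G_sq)
  also have "\<dots> \<le> real_of_int (\<Sum>x\<in>{0..<int p}. (G x)\<^sup>2)"
    unfolding of_int_le_iff
    by (intro sum_mono2) (auto simp: X_def character_run_def)
  also have "\<dots> = (\<Sum>v\<in>T. \<Sum>w\<in>T. real_of_int (P v w))"
    unfolding sum_G by simp
  also have "\<dots> \<le> (\<Sum>v\<in>T. \<Sum>w\<in>T. B + (if v = w then real p else 0))"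
    by (intro sum_mono P_le)
  also have "\<dots> = real W ^ (2 * s) * B + real W ^ s * real p"
    using finT by (simp add: sum.distrib card_T power_add mult_2) (simp add: algebra_simps)
  also have "\<dots> = (B + real p / real W ^ s) * real W ^ (2 * s)"
    using W by (simp add: distrib_right power_add mult_2)
  finally have "real (card (X - Z)) * real W ^ (2 * s) \<le> (B + real p / real W ^ s) * real W ^ (2 * s)" .
  then have "real (card (X - Z)) \<le> B + real p / real W ^ s"
    using W by simp
  moreover have "card X \<le> card (X - Z) + card Z"
    using diff_card_le_card_Diff[of Z X] finX by (simp add: Z_def)
  ultimately show ?thesis
    using card_Z unfolding X_def B_def by linarith
qed

section \<open>The divisor bound\<close>

text \<open>Every divisor of \<open>a * b\<close> is a divisor of \<open>a\<close> times a divisor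
  of \<open>b\<close>, whether or not \<open>a\<close> and \<open>b\<close> are coprime.\<close>

lemma card_divisors_mult_le:
  fixes a b :: nat
  assumes "a > 0" "b > 0"
  shows "card {d. d dvd a * b} \<le> card {d. d dvd a} * card {d. d dvd b}"
proof -
  have "{d. d dvd a * b} \<subseteq> (\<lambda>(x, y). x * y) ` ({d. d dvd a} \<times> {d. d dvd b})"
  proof
    fix d assume "d \<in> {d. d dvd a * b}"
    then obtain x y where "d = x * y" "x dvd a" "y dvd b"
      using division_decomp[of d a b] by auto
    then show "d \<in> (\<lambda>(x, y). x * y) ` ({d. d dvd a} \<times> {d. d dvd b})"
      by (intro image_eqI[of _ _ "(x, y)"]) auto
  qed
  then have "card {d. d dvd a * b} \<le> card ({d. d dvd a} \<times> {d. d dvd b})"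
    using assms by (intro surj_card_le) auto
  then show ?thesis by (simp add: card_cartesian_product)
qed

lemma card_divisors_prime_power_le:
  fixes q :: nat
  assumes "prime q"
  shows "card {d. d dvd q ^ a} \<le> a + 1"
proof -
  have "{d. d dvd q ^ a} \<subseteq> (\<lambda>i. q ^ i) ` {..a}"
    using assms by (auto simp: divides_primepow_nat)
  then have "card {d. d dvd q ^ a} \<le> card {..a}"
    by (intro surj_card_le) auto
  then show ?thesis by simp
qed

text \<open>Each prime factor q at most doubles the number of divisors, and 2 is at most
  q^\<epsilon> because q is at least \<open>y\<close>.\<close>

lemma card_divisors_rough_le:
  fixes \<epsilon> :: real
  assumes y: "2 \<le> real y powr \<epsilon>" and "\<epsilon> > 0"
    and "n > 0" "\<And>q. prime q \<Longrightarrow> q dvd n \<Longrightarrow> y \<le> q"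
  shows "real (card {d. d dvd n}) \<le> real n powr \<epsilon>"
  using assms(3,4)
proof (induction n rule: less_induct)
  case (less n)
  show ?case
  proof (cases "n = 1")
    case False
    then obtain q where q: "prime q" "q dvd n"
      using prime_factor_nat by blast
    then obtain n' where n': "n = q * n'" by (auto simp: dvd_def)
    have pos: "n' > 0" "q > 1" using less.prems(1) n' q prime_gt_1_nat by auto
    have "real (card {d. d dvd n}) \<le> real (card {d. d dvd q ^ 1} * card {d. d dvd n'})"
      unfolding n' of_nat_le_iff using card_divisors_mult_le[of q n'] pos by simp
    also have "\<dots> \<le> real (2 * card {d. d dvd n'})"
      unfolding of_nat_le_iff using card_divisors_prime_power_le[OF q(1), of 1] by (intro mult_right_mono) auto
    also have "\<dots> = 2 * real (card {d. d dvd n'})" by simp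
    also have "\<dots> \<le> real y powr \<epsilon> * real n' powr \<epsilon>"
    proof (intro mult_mono y)
      show "real (card {d. d dvd n'}) \<le> real n' powr \<epsilon>"
        using less.prems pos n' by (intro less.IH) auto
    qed auto
    also have "\<dots> \<le> real q powr \<epsilon> * real n' powr \<epsilon>"
      using less.prems(2)[OF q] assms(2) by (intro mult_right_mono powr_mono2) auto
    also have "\<dots> = real n powr \<epsilon>"
      by (simp add: n' powr_mult)
    finally show ?thesis .
  qed simp
qed

text \<open>Primes from \<open>Y\<close> on cost no constant by the rough case, and each of the
  finitely many primes below \<open>Y\<close> costs one factor \<open>c\<close>.\<close>

lemma card_divisors_le_powr:
  fixes \<epsilon> :: real
  assumes \<epsilon>: "\<epsilon> > 0"
  obtains C where "C > 0" "\<And>n. n > 0 \<Longrightarrow> real (card {d. d dvd n}) \<le> C * real n powr \<epsilon>"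
proof -
  \<comment> \<open>Chosen so that a + 1 \<le> c (1 + a \<epsilon> ln 2), and the last factor is at
    most 2^(a \<epsilon>).\<close>
  define c where "c = 1 + 1 / (\<epsilon> * ln 2)"
  have c1: "c \<ge> 1" using \<epsilon> by (simp add: c_def)
  have c: "real a + 1 \<le> c * real (q ^ a) powr \<epsilon>" if "prime q" for a q :: nat
  proof -
    have "real a + 1 \<le> c * (1 + real a * \<epsilon> * ln 2)"
      using \<epsilon> by (simp add: c_def field_simps)
    also have "\<dots> \<le> c * exp (real a * \<epsilon> * ln 2)"
      using c1 exp_ge_add_one_self by (intro mult_left_mono) auto
    also have "exp (real a * \<epsilon> * ln 2) = (2 ^ a) powr \<epsilon>"
      by (simp add: powr_def ln_realpow mult_ac)
    also have "c * (2 ^ a) powr \<epsilon> \<le> c * real (q ^ a) powr \<epsilon>"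
      using c1 \<epsilon> prime_ge_2_nat[OF that] by (intro mult_left_mono powr_mono2) (auto intro!: power_mono)
    finally show ?thesis .
  qed
  define rough where "rough = (\<lambda>(y::nat) n::nat. n > 0 \<and> (\<forall>q. prime q \<longrightarrow> q dvd n \<longrightarrow> y \<le> q))"
  define Y where "Y = nat \<lceil>2 powr (1 / \<epsilon>)\<rceil>"
  have "2 powr (1 / \<epsilon>) \<le> real Y" unfolding Y_def by (rule real_nat_ceiling_ge)
  then have "(2 powr (1 / \<epsilon>)) powr \<epsilon> \<le> real Y powr \<epsilon>"
    using \<epsilon> by (intro powr_mono2) auto
  then have Y: "2 \<le> real Y powr \<epsilon>" using \<epsilon> by (simp add: powr_powr)
  \<comment> \<open>Downward induction from \<open>Y\<close> to 0. One step admits the prime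
    \<open>y\<close> as a factor by splitting off its full power, while a \<open>y\<close> that is
    not prime changes nothing.\<close>
  have "\<exists>C>0. \<forall>n. rough y n \<longrightarrow> real (card {d. d dvd n}) \<le> C * real n powr \<epsilon>" if "y \<le> Y" for y
    using that
  proof (induction y rule: inc_induct)
    case base
    show ?case
      using card_divisors_rough_le[OF Y \<epsilon>] by (intro exI[of _ 1]) (auto simp: rough_def)
  next
    case (step y)
    then obtain C where C: "C > 0"
      "\<And>n. rough (Suc y) n \<Longrightarrow> real (card {d. d dvd n}) \<le> C * real n powr \<epsilon>"
      by blast
    show ?case
    proof (intro exI[of _ "c * C"] conjI allI impI)
      show "0 < c * C" using c1 C by simp
      fix n assume n: "rough y n"
      show "real (card {d. d dvd n}) \<le> c * C * real n powr \<epsilon>"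
      proof (cases "prime y")
        case False
        then have "rough (Suc y) n"
          using n unfolding rough_def by (metis Suc_leI le_neq_implies_less)
        then have "real (card {d. d dvd n}) \<le> C * real n powr \<epsilon>" by (rule C)
        also have "\<dots> \<le> c * (C * real n powr \<epsilon>)"
          using mult_right_mono[OF c1, of "C * real n powr \<epsilon>"] C(1) by simp
        finally show ?thesis by (simp add: mult.assoc)
      next
        case True
        define a where "a = multiplicity y n"
        obtain n' where n': "n = y ^ a * n'" "\<not> y dvd n'"
          using multiplicity_decompose'[of n y] n True unfolding rough_def a_def
          by (metis not_prime_unit not_gr_zero)
        have pos: "n' > 0" "y ^ a > 0" using n n'(1) by (auto simp: rough_def)
        have "rough (Suc y) n'"
          unfolding rough_def
        proof (intro conjI allI impI pos)
          fix q assume q: "prime q" "q dvd n'"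
          then have "y \<le> q" using n n'(1) unfolding rough_def by (metis dvd_mult)
          moreover have "q \<noteq> y" using q n'(2) by auto
          ultimately show "Suc y \<le> q" by simp
        qed
        then have n'_le: "real (card {d. d dvd n'}) \<le> C * real n' powr \<epsilon>" by (rule C)
        have "real (card {d. d dvd n}) \<le> real (card {d. d dvd y ^ a} * card {d. d dvd n'})"
          unfolding of_nat_le_iff using card_divisors_mult_le[OF pos(2,1)] n'(1) by simp
        also have "\<dots> \<le> (real a + 1) * (C * real n' powr \<epsilon>)"
          using card_divisors_prime_power_le[OF True, of a] n'_le by (simp add: mult_mono)
        also have "\<dots> \<le> (c * real (y ^ a) powr \<epsilon>) * (C * real n' powr \<epsilon>)"
          using c[OF True] C by (intro mult_right_mono) auto
        also have "\<dots> = c * C * (real (y ^ a) * real n') powr \<epsilon>"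
          by (simp add: powr_mult)
        also have "real (y ^ a) * real n' = real n"
          by (simp add: n'(1))
        finally show ?thesis .
      qed
    qed
  qed
  from this[of 0] obtain C where "C > 0"
    "\<And>n. rough 0 n \<Longrightarrow> real (card {d. d dvd n}) \<le> C * real n powr \<epsilon>" by auto
  then show ?thesis by (intro that[of C]) (auto simp: rough_def)
qed

section \<open>Counting quotients\<close>

text \<open>Cauchy-Schwarz for the fibre sizes: they sum to \<open>card S\<close>, and their squares
  sum to the number of collisions.\<close>

lemma card_power2_le_card_image_mult_collisions:
  assumes S: "finite S"
  shows "(card S)\<^sup>2 \<le> card (g ` S) * card {(s, t) \<in> S \<times> S. g s = g t}"
proof -
  define \<nu> where "\<nu> = (\<lambda>x. card {s \<in> S. g s = x})"
  have "card S = (\<Sum>x\<in>g ` S. \<nu> x)"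
    unfolding \<nu>_def using sum.image_gen[OF S, of "\<lambda>_. 1 :: nat" g] by simp
  moreover have "card {(s, t) \<in> S \<times> S. g s = g t} = (\<Sum>x\<in>g ` S. (\<nu> x)\<^sup>2)"
  proof -
    have "{(s, t) \<in> S \<times> S. g s = g t} = (\<Union>x\<in>g ` S. {s \<in> S. g s = x} \<times> {s \<in> S. g s = x})"
      by auto
    also have "card \<dots> = (\<Sum>x\<in>g ` S. card ({s \<in> S. g s = x} \<times> {s \<in> S. g s = x}))"
      using S by (intro card_UN_disjoint) auto
    finally show ?thesis
      by (simp add: \<nu>_def card_cartesian_product power2_eq_square)
  qed
  moreover have "(\<Sum>x\<in>g ` S. real (\<nu> x))\<^sup>2 \<le> (\<Sum>x\<in>g ` S. (real (\<nu> x))\<^sup>2) * real (card (g ` S))"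
    by (rule sum_squared_le_sum_of_squares)
  ultimately have "real ((card S)\<^sup>2) \<le> real (card (g ` S) * card {(s, t) \<in> S \<times> S. g s = g t})"
    by (simp add: mult.commute)
  then show ?thesis unfolding of_nat_le_iff .
qed

text \<open>The first two factors are divisors of \<open>y\<close>, and they determine the
  third.\<close>

lemma card_triple_product_le:
  fixes A B U :: "int set"
  assumes pos: "A \<subseteq> {1..}" "B \<subseteq> {1..}" "U \<subseteq> {1..}" and y: "y > 0"
  shows "card {(m, n, u) \<in> A \<times> B \<times> U. m * n * u = y} \<le> (card {d. d dvd nat y})\<^sup>2"
proof -
  let ?D = "{d. d dvd nat y}"
  have "card {(m, n, u) \<in> A \<times> B \<times> U. m * n * u = y} \<le> card (?D \<times> ?D)"
  proof (rule card_inj_on_le)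
    show "inj_on (\<lambda>(m, n, u). (nat m, nat n)) {(m, n, u) \<in> A \<times> B \<times> U. m * n * u = y}"
    proof (rule inj_onI)
      fix t t' assume t: "t \<in> {(m, n, u) \<in> A \<times> B \<times> U. m * n * u = y}"
        "t' \<in> {(m, n, u) \<in> A \<times> B \<times> U. m * n * u = y}"
        and eq: "(\<lambda>(m, n, u). (nat m, nat n)) t = (\<lambda>(m, n, u). (nat m, nat n)) t'"
      obtain m n u where 1: "t = (m, n, u)" by (cases t)
      obtain m' n' u' where 2: "t' = (m', n', u')" by (cases t')
      have ge: "m \<ge> 1" "n \<ge> 1" "m' \<ge> 1" "n' \<ge> 1" using pos t 1 2 by auto
      then have "m = m'" "n = n'" using eq 1 2 by auto
      moreover have "m * n * u = m' * n' * u'" using t 1 2 by simp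
      ultimately show "t = t'" using ge 1 2 by simp
    qed
    show "(\<lambda>(m, n, u). (nat m, nat n)) ` {(m, n, u) \<in> A \<times> B \<times> U. m * n * u = y} \<subseteq> ?D \<times> ?D"
    proof (rule image_subsetI)
      fix t assume t: "t \<in> {(m, n, u) \<in> A \<times> B \<times> U. m * n * u = y}"
      obtain m n u where 1: "t = (m, n, u)" by (cases t)
      with t have "m \<in> A" "n \<in> B" "u \<in> U" "y = m * n * u" by auto
      moreover from this have "m \<ge> 1" "n \<ge> 1" "u \<ge> 1" using pos by auto
      ultimately have "nat y = nat m * nat n * nat u" by (simp add: nat_mult_distrib)
      then show "(\<lambda>(m, n, u). (nat m, nat n)) t \<in> ?D \<times> ?D" by (simp add: 1)
    qed
    show "finite (?D \<times> ?D)" using y by simp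
  qed
  then show ?thesis by (simp add: card_cartesian_product power2_eq_square)
qed

text \<open>Within a residue class a number is determined by its quotient by \<open>p\<close>, which
  lies between 0 and \<open>Q div p\<close>.\<close>

lemma card_residue_class_le:
  fixes p Q :: nat
  assumes "p > 0"
  shows "card {y \<in> {1..int Q}. int p dvd a - y} \<le> Q div p + 1"
proof -
  have "card {y \<in> {1..int Q}. int p dvd a - y} \<le> card {0..int (Q div p)}"
  proof (rule card_inj_on_le)
    show "inj_on (\<lambda>y. y div int p) {y \<in> {1..int Q}. int p dvd a - y}"
    proof (rule inj_onI, clarify)
      fix x y assume x: "int p dvd a - x" and y: "int p dvd a - y" and div: "x div int p = y div int p"
      have "(a - y) - (a - x) = x - y" by simp
      with dvd_diff[OF y x] have "int p dvd x - y" by metis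
      then have mod: "x mod int p = y mod int p" unfolding mod_eq_dvd_iff .
      have "x = x div int p * int p + x mod int p" by (rule div_mult_mod_eq[symmetric])
      also have "\<dots> = y" unfolding div mod by (rule div_mult_mod_eq)
      finally show "x = y" .
    qed
    show "(\<lambda>y. y div int p) ` {y \<in> {1..int Q}. int p dvd a - y} \<subseteq> {0..int (Q div p)}"
    proof (rule image_subsetI)
      fix y assume y: "y \<in> {y \<in> {1..int Q}. int p dvd a - y}"
      then have "y div int p \<le> int Q div int p" using assms by (intro zdiv_mono1) auto
      moreover have "0 \<le> y div int p" using y assms by (simp add: pos_imp_zdiv_nonneg_iff)
      moreover have "int (Q div p) = int Q div int p" by (rule zdiv_int)
      ultimately show "y div int p \<in> {0..int (Q div p)}" by simp
    qed
  qed simp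
  then show ?thesis by simp
qed

text \<open>
  A collision \<open>m n / u \<equiv> m' n' / u'\<close> amounts to \<open>m n u' \<equiv> m' n' u\<close> modulo \<open>p\<close>. Given the left-hand
  side, the right-hand side is one of few integers, each of which has few factorizations.
\<close>

lemma card_le_card_quotients:
  fixes A B U :: "int set" and g :: "int \<times> int \<times> int \<Rightarrow> int" and p Q :: nat and D :: real
  assumes fin: "finite A" "finite B" "finite U"
    and pos: "A \<subseteq> {1..}" "B \<subseteq> {1..}" "U \<subseteq> {1..}" and p: "p > 0"
    and Q: "\<And>m n u. m \<in> A \<Longrightarrow> n \<in> B \<Longrightarrow> u \<in> U \<Longrightarrow> m * n * u \<le> int Q"
    and D: "\<And>y. y > 0 \<Longrightarrow> y \<le> Q \<Longrightarrow> real (card {d. d dvd y}) \<le> D"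
    and g: "\<And>m n u. m \<in> A \<Longrightarrow> n \<in> B \<Longrightarrow> u \<in> U \<Longrightarrow> [u * g (m, n, u) = m * n] (mod int p)"
  shows "real (card A * card B * card U)
    \<le> real (card (g ` (A \<times> B \<times> U))) * (real Q / real p + 1) * D\<^sup>2"
proof -
  define S where "S = A \<times> B \<times> U"
  define h where "h = (\<lambda>(m, n, u). m * n * u :: int)"
  define C where "C = {(s, t) \<in> S \<times> S. g s = g t}"
  have finS: "finite S" using fin by (simp add: S_def)
  have card_S: "card S = card A * card B * card U" by (simp add: S_def card_cartesian_product)
  have h_range: "h s \<in> {1..int Q}" if mem: "s \<in> S" for s
  proof -
    obtain m n u where s: "s = (m, n, u)" "m \<in> A" "n \<in> B" "u \<in> U"
      using mem by (cases s) (auto simp: S_def)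
    then have "m \<ge> 1" "n \<ge> 1" "u \<ge> 1" using pos by auto
    then have "m * n * u > 0" by simp
    then show ?thesis using Q[OF s(2-4)] by (simp add: h_def s(1))
  qed
  have fibre: "real (card {t \<in> S. int p dvd a - h t}) \<le> (real Q / real p + 1) * D\<^sup>2" for a
  proof -
    let ?Y = "{y \<in> {1..int Q}. int p dvd a - y}"
    have finY: "finite ?Y" by (rule finite_subset[of _ "{1..int Q}"]) auto
    have "{t \<in> S. int p dvd a - h t} \<subseteq> (\<Union>y\<in>?Y. {t \<in> S. h t = y})"
      using h_range by auto
    then have "card {t \<in> S. int p dvd a - h t} \<le> card (\<Union>y\<in>?Y. {t \<in> S. h t = y})"
      using finS finY by (intro card_mono) auto
    also have "\<dots> \<le> (\<Sum>y\<in>?Y. card {t \<in> S. h t = y})"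
      using finY by (rule card_UN_le)
    finally have "real (card {t \<in> S. int p dvd a - h t}) \<le> real (\<Sum>y\<in>?Y. card {t \<in> S. h t = y})"
      unfolding of_nat_le_iff .
    also have "\<dots> = (\<Sum>y\<in>?Y. real (card {t \<in> S. h t = y}))"
      by (rule of_nat_sum)
    also have "\<dots> \<le> (\<Sum>y\<in>?Y. D\<^sup>2)"
    proof (rule sum_mono)
      fix y assume y: "y \<in> ?Y"
      have "{t \<in> S. h t = y} = {(m, n, u) \<in> A \<times> B \<times> U. m * n * u = y}"
        by (auto simp: S_def h_def)
      then have "card {t \<in> S. h t = y} \<le> (card {d. d dvd nat y})\<^sup>2"
        using card_triple_product_le[OF pos, of y] y by simp
      then have "real (card {t \<in> S. h t = y}) \<le> real ((card {d. d dvd nat y})\<^sup>2)"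
        unfolding of_nat_le_iff .
      also have "\<dots> = (real (card {d. d dvd nat y}))\<^sup>2"
        by simp
      also have "\<dots> \<le> D\<^sup>2"
        using D[of "nat y"] y by (intro power_mono) auto
      finally show "real (card {t \<in> S. h t = y}) \<le> D\<^sup>2" .
    qed
    also have "\<dots> = real (card ?Y) * D\<^sup>2" by simp
    also have "\<dots> \<le> (real Q / real p + 1) * D\<^sup>2"
    proof (rule mult_right_mono)
      have "real (card ?Y) \<le> real (Q div p + 1)"
        unfolding of_nat_le_iff by (rule card_residue_class_le[OF p])
      also have "\<dots> \<le> real Q / real p + 1"
        using of_nat_div_le_of_nat[of Q p, where ?'a = real] by simp
      finally show "real (card ?Y) \<le> real Q / real p + 1" .
    qed simp
    finally show ?thesis .
  qed
  have "card C \<le> card (SIGMA s:S. {t \<in> S. int p dvd h s - h t})"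
  proof (rule card_inj_on_le)
    \<comment> \<open>Exchanging the two denominators clears them: a pair with equal quotients
      becomes a pair of triples whose products are congruent modulo \<open>p\<close>. The exchange
      can be undone, so it is injective.\<close>
    let ?sw = "\<lambda>((m, n, u), (m', n', u')). ((m, n, u'), (m', n', u)) :: (int \<times> int \<times> int) \<times> (int \<times> int \<times> int)"
    show "inj_on ?sw C" by (auto simp: inj_on_def)
    show "?sw ` C \<subseteq> (SIGMA s:S. {t \<in> S. int p dvd h s - h t})"
    proof (rule image_subsetI)
      fix c assume c: "c \<in> C"
      obtain m n u m' n' u' where c_eq: "c = ((m, n, u), (m', n', u'))" by (metis surj_pair)
      with c have mem: "m \<in> A" "n \<in> B" "u \<in> U" "m' \<in> A" "n' \<in> B" "u' \<in> U"
        and eq: "g (m, n, u) = g (m', n', u')" by (auto simp: C_def S_def)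
      have "[m * n * u' = (u * g (m, n, u)) * u'] (mod int p)"
        by (intro cong_mult cong_refl cong_sym[OF g] mem)
      also have "(u * g (m, n, u)) * u' = (u' * g (m', n', u')) * u"
        by (simp add: eq)
      also have "[\<dots> = (m' * n') * u] (mod int p)"
        by (intro cong_mult cong_refl g mem)
      finally have "int p dvd m * n * u' - m' * n' * u"
        by (simp add: cong_iff_dvd_diff)
      then show "?sw c \<in> (SIGMA s:S. {t \<in> S. int p dvd h s - h t})"
        using mem by (simp add: c_eq S_def h_def)
    qed
    show "finite (SIGMA s:S. {t \<in> S. int p dvd h s - h t})" using finS by auto
  qed
  also have "\<dots> = (\<Sum>s\<in>S. card {t \<in> S. int p dvd h s - h t})"
    using finS by (subst card_SigmaI) auto
  finally have "real (card C) \<le> real (\<Sum>s\<in>S. card {t \<in> S. int p dvd h s - h t})"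
    unfolding of_nat_le_iff .
  also have "\<dots> = (\<Sum>s\<in>S. real (card {t \<in> S. int p dvd h s - h t}))"
    by (rule of_nat_sum)
  also have "\<dots> \<le> (\<Sum>s\<in>S. (real Q / real p + 1) * D\<^sup>2)"
    by (intro sum_mono fibre)
  also have "\<dots> = real (card S) * ((real Q / real p + 1) * D\<^sup>2)" by simp
  finally have C_le: "real (card C) \<le> real (card S) * ((real Q / real p + 1) * D\<^sup>2)" .
  have "real ((card S)\<^sup>2) \<le> real (card (g ` S) * card C)"
    unfolding of_nat_le_iff C_def by (rule card_power2_le_card_image_mult_collisions[OF finS])
  also have "\<dots> \<le> real (card (g ` S)) * (real (card S) * ((real Q / real p + 1) * D\<^sup>2))"
    unfolding of_nat_mult by (intro mult_left_mono C_le) simp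
  finally have "real (card S) * real (card S)
      \<le> real (card S) * (real (card (g ` S)) * (real Q / real p + 1) * D\<^sup>2)"
    by (simp add: power2_eq_square mult_ac)
  then have "real (card S) \<le> real (card (g ` S)) * (real Q / real p + 1) * D\<^sup>2"
    by (cases "card S = 0") (simp_all add: mult_le_cancel_left)
  then show ?thesis unfolding card_S unfolding S_def .
qed

section \<open>Residues near products\<close>

lemma eventually_powr_gt:
  fixes a c :: real
  assumes "a > 0"
  shows "\<forall>\<^sub>F x in at_top. c < x powr a"
proof -
  have "c < x powr a" if x: "x \<ge> (\<bar>c\<bar> + 1) powr (1 / a)" for x
  proof -
    have "((\<bar>c\<bar> + 1) powr (1 / a)) powr a \<le> x powr a"
      using x assms by (intro powr_mono2) auto
    then show ?thesis using assms by (simp add: powr_powr)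
  qed
  then show ?thesis by (auto simp: eventually_at_top_linorder)
qed

text \<open>With block length W the integer part of p^\<delta>, rounding loses at most a factor 2,
  so W^s \<ge> p / 2^s by \<open>1 \<le> real s * \<delta>\<close>. The diagonal term p / W^s is
  then bounded by 2^s.\<close>

lemma card_character_run_le_sqrt:
  fixes \<delta> :: real
  assumes p: "prime p" "2 < p" and \<delta>: "0 < \<delta>" "\<delta> \<le> 1 / 2" "1 \<le> real s * \<delta>"
    and large: "2 \<le> real p powr \<delta>" "real s < real p powr (1 - \<delta>)" "64 * (2 * s + 3)\<^sup>2 \<le> p"
  shows "real (card (character_run p (int (s * nat \<lfloor>real p powr \<delta>\<rfloor>))))
    \<le> (27 * real s + 2 ^ s + 18) * sqrt (real p)"
proof -
  define W where "W = nat \<lfloor>real p powr \<delta>\<rfloor>"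
  have W_le: "real W \<le> real p powr \<delta>"
    unfolding W_def by (rule of_nat_floor) simp
  have W_ge: "real W \<ge> real p powr \<delta> / 2"
    using large(1) floor_correct[of "real p powr \<delta>"] unfolding W_def by linarith
  have W: "W > 0" using W_ge large(1) by (intro Nat.gr0I) auto
  have p1: "real p \<ge> 1" using p by simp
  have sW: "real (s * W) < real p"
  proof -
    have "real (s * W) \<le> real s * real p powr \<delta>"
      using W_le by (simp add: mult_left_mono)
    also have "\<dots> < real p powr (1 - \<delta>) * real p powr \<delta>"
      using large p by (intro mult_strict_right_mono) auto
    also have "\<dots> = real p" using p by (simp add: powr_add[symmetric])
    finally show ?thesis .
  qed
  have "real p powr \<delta> \<le> real p powr (1 / 2)"
    using p1 \<delta> by (intro powr_mono) auto
  then have "real W \<le> sqrt (real p)"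
    using W_le p by (simp add: powr_half_sqrt)
  then have 1: "real (s * W) \<le> real s * sqrt (real p)"
    by (simp add: mult_left_mono)
  have "real p / 2 ^ s \<le> real p powr (\<delta> * real s) / 2 ^ s"
    using p1 \<delta> powr_mono[of 1 "\<delta> * real s" "real p"] by (intro divide_right_mono) (auto simp: mult.commute)
  also have "\<dots> = (real p powr \<delta> / 2) ^ s"
    using p by (simp add: power_divide powr_powr[symmetric] powr_realpow)
  also have "\<dots> \<le> real W ^ s"
    using W_ge by (intro power_mono) auto
  finally have "real p / real W ^ s \<le> 2 ^ s * 1"
    using W by (simp add: field_simps)
  also have "\<dots> \<le> 2 ^ s * sqrt (real p)"
    using p1 by (intro mult_left_mono) auto
  finally have 2: "real p / real W ^ s \<le> 2 ^ s * sqrt (real p)" .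
  have "real (card (character_run p (int (s * W))))
      \<le> real (s * W) + real p / real W ^ s + (26 * real s + 18) * sqrt (real p)"
    by (rule card_character_run_le[OF p W _ large(3)]) (use sW in \<open>simp only: of_nat_less_iff\<close>)
  with 1 2 show ?thesis
    unfolding W_def[symmetric] by (simp add: algebra_simps)
qed

text \<open>With x = p and t = M N, the left side bounds the largest shift u v used below, and the
  right side is the range that p^(1 + \<eta>) allows for \<open>k\<close>. If the quotient
  \<open>y\<close> is at least 1, then y + 1 \<le> 2 y \<le> 2 y^2 and the first summand suffices.
  Otherwise the second one does.\<close>

lemma shift_length_le:
  fixes x t \<delta> \<eta> s :: real
  assumes x: "1 \<le> x" and t: "0 < t" and \<delta>: "0 < \<delta>" "4 * \<delta> \<le> \<eta>" and s: "0 \<le> s" "2 * s \<le> x powr \<delta>"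
  shows "(x powr (1 / 2 + \<delta>) / t + 1) * (s * x powr \<delta>) \<le> x powr (1 + \<eta>) / t\<^sup>2 + x powr \<eta>"
proof -
  define y where "y = x powr (1 / 2 + \<delta>) / t"
  have y: "y > 0" using x t by (simp add: y_def)
  have "2 * (s * x powr \<delta>) \<le> x powr \<delta> * x powr \<delta>"
    using mult_right_mono[OF s(2), of "x powr \<delta>"] by (simp add: mult.assoc)
  also have "\<dots> = x powr (2 * \<delta>)"
    unfolding mult_2 by (rule powr_add[symmetric])
  finally have main: "2 * (s * x powr \<delta>) \<le> x powr (2 * \<delta>)" .
  show ?thesis
  proof (cases "1 \<le> y")
    case True
    have "(y + 1) * (s * x powr \<delta>) \<le> (2 * y) * (s * x powr \<delta>)"
      using True s by (intro mult_right_mono) auto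
    also have "\<dots> = y * (2 * (s * x powr \<delta>))" by simp
    also have "\<dots> \<le> y * x powr (2 * \<delta>)"
      using main y by (intro mult_left_mono) auto
    also have "\<dots> \<le> (y * y) * x powr (\<eta> - 2 * \<delta>)"
      using True \<delta> x by (intro mult_mono powr_mono) (auto simp: mult_le_cancel_left1)
    also have "\<dots> = x powr (1 / 2 + \<delta>) * x powr (1 / 2 + \<delta>) * x powr (\<eta> - 2 * \<delta>) / t\<^sup>2"
      by (simp add: y_def power2_eq_square)
    also have "x powr (1 / 2 + \<delta>) * x powr (1 / 2 + \<delta>) * x powr (\<eta> - 2 * \<delta>) = x powr (1 + \<eta>)"
      unfolding powr_add[symmetric] by (rule arg_cong[where f = "\<lambda>e. x powr e"]) simp
    also have "x powr (1 + \<eta>) / t\<^sup>2 \<le> x powr (1 + \<eta>) / t\<^sup>2 + x powr \<eta>" by simp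
    finally show ?thesis unfolding y_def .
  next
    case False
    then have "(y + 1) * (s * x powr \<delta>) \<le> 2 * (s * x powr \<delta>)"
      using s by (intro mult_right_mono) auto
    also have "\<dots> \<le> x powr (2 * \<delta>)" by (rule main)
    also have "\<dots> \<le> x powr \<eta>" using x \<delta> by (intro powr_mono) auto
    also have "\<dots> \<le> x powr (1 + \<eta>) / t\<^sup>2 + x powr \<eta>" by simp
    finally show ?thesis unfolding y_def .
  qed
qed

theorem theorem2p11:
  fixes r :: nat and c0 \<eta> :: real
  assumes "r \<ge> 1" and "0 < c0" and "c0 < 1" and "\<eta> > 0"
  shows "\<exists>P :: real. \<forall>p :: nat. prime p \<longrightarrow> real p \<ge> P \<longrightarrow>
    (\<forall>(M :: real) (N :: real) (A :: int set) (B :: int set).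
       M > 0 \<longrightarrow> N > 0 \<longrightarrow>
       M ^ 4 * N ^ 2 \<ge> real p powr (1 + 1 / real r + \<eta>) \<longrightarrow>
       A \<subseteq> {1..int p} \<longrightarrow> B \<subseteq> {1..int p} \<longrightarrow>
       real_of_int ` A \<subseteq> {M..2 * M} \<longrightarrow> real_of_int ` B \<subseteq> {N..2 * N} \<longrightarrow>
       real (card A) \<ge> c0 * M \<longrightarrow> real (card B) \<ge> c0 * N \<longrightarrow>
       (\<exists>m\<in>A. \<exists>n\<in>B. \<exists>k :: int. k > 0 \<and>
          real_of_int k \<le> real p powr (1 + 1 / real r + \<eta>) * (M * N) powi (-2) + real p powr \<eta> \<and>
          quadratic_residue p (m * n + k)))"
proof -

  \<comment> \<open>Parameters and threshold\<close>
  define \<delta> where "\<delta> = min (\<eta> / 4) (1 / 8)"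
  have \<delta>: "0 < \<delta>" "4 * \<delta> \<le> \<eta>" "\<delta> \<le> 1 / 8" using assms by (auto simp: \<delta>_def)
  define s where "s = nat \<lceil>1 / \<delta>\<rceil>"
  have "1 / \<delta> \<le> real s" unfolding s_def by (rule real_nat_ceiling_ge)
  then have s\<delta>: "1 \<le> real s * \<delta>" using \<delta> by (simp add: field_simps)
  then have s1: "s \<ge> 1" by (cases s) auto
  \<comment> \<open>The exponent \<delta>/8 is chosen because the divisor bound enters squared, at
    arguments of size O(p^2), and so costs p^(\<delta>/2), half of the available gain
    p^\<delta>.\<close>
  obtain C2 where C2: "C2 > 0"
    "\<And>n. n > 0 \<Longrightarrow> real (card {d. d dvd n}) \<le> C2 * real n powr (\<delta> / 8)"
    using card_divisors_le_powr[of "\<delta> / 8"] \<delta> by auto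
  define C1 where "C1 = 27 * real s + 2 ^ s + 18"
  define C3 where "C3 = C2\<^sup>2 * 8 powr (\<delta> / 4)"
  have C1: "C1 > 0" unfolding C1_def by (simp add: add_nonneg_pos)
  have C3: "C3 > 0" using C2 by (simp add: C3_def)
  \<comment> \<open>In order, the conditions serve the character sum bound, the comparison of shift
    lengths, \<open>u0 < p\<close>, the final contradiction, and \<open>s * W < p\<close>.\<close>
  have "\<forall>\<^sub>F x :: real in at_top. real (64 * (2 * s + 3)\<^sup>2) < x powr 1 \<and> 2 * real s < x powr \<delta> \<and>
      5 < x powr (1 / 2 - \<delta>) \<and> 5 * C1 * C3 / c0\<^sup>2 < x powr (\<delta> / 2) \<and> real s < x powr (1 - \<delta>)"
    using \<delta> by (intro eventually_conj eventually_powr_gt) auto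
  then obtain P where P: "\<And>x. x \<ge> P \<Longrightarrow> real (64 * (2 * s + 3)\<^sup>2) < x powr 1 \<and> 2 * real s < x powr \<delta> \<and>
      5 < x powr (1 / 2 - \<delta>) \<and> 5 * C1 * C3 / c0\<^sup>2 < x powr (\<delta> / 2) \<and> real s < x powr (1 - \<delta>)"
    by (auto simp: eventually_at_top_linorder)
  show ?thesis
  proof (intro exI[of _ P] allI impI)
    fix p :: nat and M N :: real and A B :: "int set"
    assume p: "prime p" and "real p \<ge> P" and MN: "M > 0" "N > 0"
      and sub: "A \<subseteq> {1..int p}" "B \<subseteq> {1..int p}"
      and intervals: "real_of_int ` A \<subseteq> {M..2 * M}" "real_of_int ` B \<subseteq> {N..2 * N}"
      and dense: "real (card A) \<ge> c0 * M" "real (card B) \<ge> c0 * N"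

    \<comment> \<open>Sizes of the intervals and of the denominators\<close>
    define x where "x = real p"
    define t where "t = M * N"
    have x0: "x > 0" using p prime_gt_0_nat by (simp add: x_def)
    have large: "real (64 * (2 * s + 3)\<^sup>2) < x" "2 * real s < x powr \<delta>" "5 < x powr (1 / 2 - \<delta>)"
      "5 * C1 * C3 / c0\<^sup>2 < x powr (\<delta> / 2)" "real s < x powr (1 - \<delta>)"
      using P[OF \<open>real p \<ge> P\<close>] x0 by (auto simp: x_def)
    have large_nat: "64 * (2 * s + 3)\<^sup>2 < p" using large(1) unfolding x_def of_nat_less_iff .
    have "64 \<le> 64 * (2 * s + 3)\<^sup>2" by simp
    then have p2: "p > 2" using large_nat by linarith
    then have x1: "x \<ge> 1" by (simp add: x_def)
    have fin: "finite A" "finite B" using sub finite_subset by blast+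
    have bounds: "1 \<le> m \<and> m \<le> int p \<and> M \<le> real_of_int m \<and> real_of_int m \<le> 2 * M" if "m \<in> A" for m
      using that sub intervals by auto
    have bounds': "1 \<le> n \<and> n \<le> int p \<and> N \<le> real_of_int n \<and> real_of_int n \<le> 2 * N" if "n \<in> B" for n
      using that sub intervals by auto
    have "card A > 0" "card B > 0"
      using dense MN assms(2) by (auto intro!: Nat.gr0I simp: mult_le_0_iff)
    then obtain m0 n0 where "m0 \<in> A" "n0 \<in> B" by (metis card_gt_0_iff ex_in_conv)
    \<comment> \<open>An element of \<open>A\<close> is at least 1 and at most 2 M, and likewise for
      \<open>B\<close>. This bounds M and N away from 0.\<close>
    then have M: "1 / 2 \<le> M" "M \<le> x" and N: "1 / 2 \<le> N" "N \<le> x"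
      using bounds[of m0] bounds'[of n0] unfolding x_def by linarith+
    have t: "1 / 4 \<le> t" "t \<le> x\<^sup>2"
      using mult_mono[OF M(1) N(1)] mult_mono[OF M(2) N(2)] MN x0 by (auto simp: t_def power2_eq_square)
    have t0: "t > 0" using MN by (simp add: t_def)
    \<comment> \<open>The smallest length making M N \<open>u0\<close> at least p^(1/2 + \<delta>).
      Rounding up also guarantees at least one denominator.\<close>
    define u0 where "u0 = nat \<lceil>x powr (1 / 2 + \<delta>) / t\<rceil>"
    have ratio: "x powr (1 / 2 + \<delta>) / t > 0" using x0 t by simp
    have u0_ge: "real u0 \<ge> x powr (1 / 2 + \<delta>) / t" unfolding u0_def by (rule real_nat_ceiling_ge)
    have u0_le: "real u0 \<le> x powr (1 / 2 + \<delta>) / t + 1"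
      using ratio unfolding u0_def by linarith
    have tu0: "x powr (1 / 2 + \<delta>) \<le> t * real u0"
      using u0_ge t by (simp add: field_simps)
    have u0_less: "u0 < p"
    proof -
      have "x powr (1 / 2 + \<delta>) / t \<le> x powr (1 / 2 + \<delta>) / (1 / 4)"
        using t by (intro divide_left_mono) auto
      moreover have "1 \<le> x powr (1 / 2 + \<delta>)" using x1 \<delta> by (intro ge_one_powr_ge_zero) auto
      ultimately have "real u0 \<le> 5 * x powr (1 / 2 + \<delta>)" using u0_le by simp
      also have "\<dots> < x powr (1 / 2 - \<delta>) * x powr (1 / 2 + \<delta>)"
        using large(3) x0 by (intro mult_strict_right_mono) auto
      also have "\<dots> = real p" using x0 by (simp add: powr_add[symmetric] x_def)
      finally show ?thesis by simp
    qed
    define W where "W = nat \<lfloor>x powr \<delta>\<rfloor>"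
    define U where "U = {1..int u0}"
    show "\<exists>m\<in>A. \<exists>n\<in>B. \<exists>k :: int. k > 0 \<and>
          real_of_int k \<le> real p powr (1 + 1 / real r + \<eta>) * (M * N) powi (-2) + real p powr \<eta> \<and>
          quadratic_residue p (m * n + k)"
    proof (rule ccontr)
      assume none: "\<not> ?thesis"
      have no_residue: "Legendre (m * n + k) (int p) \<noteq> 1"
        if "m \<in> A" "n \<in> B" "0 < k" "real_of_int k \<le> real (u0 * (s * W))" for m n k
      proof -
        have "real (u0 * (s * W)) \<le> (x powr (1 / 2 + \<delta>) / t + 1) * (real s * x powr \<delta>)"
          unfolding of_nat_mult W_def using u0_le of_nat_floor[of "x powr \<delta>"] t
          by (intro mult_mono) auto
        also have "\<dots> \<le> x powr (1 + \<eta>) / t\<^sup>2 + x powr \<eta>"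
          using shift_length_le[of x t \<delta> \<eta> "real s"] x1 t \<delta> large by simp
        also have "\<dots> \<le> x powr (1 + 1 / real r + \<eta>) / t\<^sup>2 + x powr \<eta>"
          using x1 by (intro add_right_mono divide_right_mono powr_mono) auto
        also have "\<dots> = real p powr (1 + 1 / real r + \<eta>) * (M * N) powi (-2) + real p powr \<eta>"
          by (simp add: x_def t_def power_int_def divide_inverse power_inverse power_mult_distrib)
        finally have "real_of_int k
            \<le> real p powr (1 + 1 / real r + \<eta>) * (M * N) powi (-2) + real p powr \<eta>"
          using that(4) by linarith
        then have "\<not> quadratic_residue p (m * n + k)"
          using none that(1-3) by blast
        then show ?thesis using Legendre_eq_1_iff[OF p] by blast
      qed

      \<comment> \<open>Quotients as starting points of runs\<close>
      define g where "g = (\<lambda>(m, n, u). SOME y. y \<in> {0..<int p} \<and> [u * y = m * n] (mod int p))"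
      have g: "g (m, n, u) \<in> {0..<int p} \<and> [u * g (m, n, u) = m * n] (mod int p)"
        if "u \<in> U" for m n u
      proof -
        have "\<not> int p dvd u" using that u0_less zdvd_not_zless[of u "int p"] by (auto simp: U_def)
        then have "coprime u (int p)"
          using p prime_imp_coprime[of "int p" u] by (simp add: coprime_commute)
        then obtain v where "[u * v = 1] (mod int p)" using cong_solve_coprime_int by blast
        then have "[u * v * (m * n) = 1 * (m * n)] (mod int p)" by (rule cong_mult) simp
        moreover have "[u * ((v * (m * n)) mod int p) = u * (v * (m * n))] (mod int p)"
          by (intro cong_mult) auto
        ultimately have "[u * ((v * (m * n)) mod int p) = m * n] (mod int p)"
          by (simp add: mult.assoc) (metis cong_trans)
        then have "\<exists>y. y \<in> {0..<int p} \<and> [u * y = m * n] (mod int p)"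
          using p2 by (intro exI[of _ "(v * (m * n)) mod int p"]) simp
        then show ?thesis unfolding g_def prod.case by (rule someI_ex)
      qed
      have "g ` (A \<times> B \<times> U) \<subseteq> character_run p (int (s * W))"
      proof (rule image_subsetI)
        fix c assume c: "c \<in> A \<times> B \<times> U"
        obtain m n u where c_eq: "c = (m, n, u)" by (metis surj_pair)
        with c have mem: "m \<in> A" "n \<in> B" "u \<in> U" by auto
        have u: "1 \<le> u" "u \<le> int u0" using mem(3) by (auto simp: U_def)
        have "\<not> int p dvd u" using u u0_less zdvd_not_zless[of u "int p"] by auto
        then have \<chi>u: "Legendre u (int p) \<in> {1, - 1}" by (auto simp: Legendre_def cong_0_iff)
        \<comment> \<open>Multiplied by the character of \<open>u\<close>, this is the symbol of m n
          + u v, which is not 1. So the only nonzero value left is minus the character of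
          \<open>u\<close>, for every \<open>v\<close>.\<close>
        have "Legendre (g c + v) (int p) \<in> {0, - Legendre u (int p)}" if v: "v \<in> {1..int (s * W)}" for v
        proof -
          have "u * v \<le> int u0 * int (s * W)"
            using u v by (intro mult_mono) auto
          then have "real_of_int (u * v) \<le> real (u0 * (s * W))"
            by (metis of_int_le_iff of_int_of_nat_eq of_nat_mult)
          moreover have "0 < u * v" using u v by simp
          ultimately have "Legendre (m * n + u * v) (int p) \<noteq> 1"
            using no_residue[OF mem(1,2)] by blast
          moreover have "[u * (g c + v) = m * n + u * v] (mod int p)"
            using g[OF mem(3), of m n] unfolding c_eq distrib_left by (intro cong_add) auto
          then have "Legendre (u * (g c + v)) (int p) = Legendre (m * n + u * v) (int p)"
            by (rule Legendre_cong)
          ultimately have "Legendre u (int p) * Legendre (g c + v) (int p) \<noteq> 1"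
            by (simp add: Legendre_mult[OF p p2])
          moreover have "Legendre (g c + v) (int p) \<in> {0, 1, - 1}" by (simp add: Legendre_def)
          ultimately show ?thesis using \<chi>u by auto
        qed
        then show "g c \<in> character_run p (int (s * W))"
          using g[OF mem(3), of m n] \<chi>u unfolding character_run_def c_eq
          by (intro CollectI conjI bexI[of _ "- Legendre u (int p)"]) auto
      qed
      then have "card (g ` (A \<times> B \<times> U)) \<le> card (character_run p (int (s * W)))"
        by (intro card_mono) auto
      moreover have "real (card (character_run p (int (s * W)))) \<le> C1 * sqrt x"
        unfolding W_def x_def C1_def
        by (rule card_character_run_le_sqrt[OF p p2])
          (use \<delta> s\<delta> s1 large large_nat in \<open>auto simp: x_def\<close>)
      ultimately have image_le: "real (card (g ` (A \<times> B \<times> U))) \<le> C1 * sqrt x" by linarith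

      \<comment> \<open>Counting the quotients and contradiction\<close>
      define T where "T = t * real u0"
      \<comment> \<open>The factor 4 comes from m \<le> 2 M and n \<le> 2 N.\<close>
      define Q where "Q = nat \<lfloor>4 * T\<rfloor>"
      define D where "D = C2 * (8 * x\<^sup>2) powr (\<delta> / 8)"
      have T0: "T > 0" using tu0 x0 unfolding T_def by (smt (verit) powr_gt_zero)
      have Q_le: "real Q \<le> 4 * T" unfolding Q_def using T0 by simp
      have "T \<le> x powr (1 / 2 + \<delta>) + t"
        using mult_left_mono[OF u0_le, of t] t0 by (simp add: T_def distrib_left)
      also have "x powr (1 / 2 + \<delta>) \<le> x powr 2" using x1 \<delta> by (intro powr_mono) auto
      finally have "real Q \<le> 8 * x\<^sup>2" using Q_le t x0 by simp
      then have D_bound: "real (card {d. d dvd y}) \<le> D" if "y > 0" "y \<le> Q" for y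
      proof -
        have "real y powr (\<delta> / 8) \<le> (8 * x\<^sup>2) powr (\<delta> / 8)"
          using \<open>real Q \<le> 8 * x\<^sup>2\<close> that \<delta> by (intro powr_mono2) auto
        then show ?thesis
          using C2(2)[OF that(1)] C2(1) unfolding D_def by (meson mult_left_mono less_imp_le order_trans)
      qed
      have "(8 * x\<^sup>2) powr (\<delta> / 8) * (8 * x\<^sup>2) powr (\<delta> / 8) = (8 * x powr 2) powr (\<delta> / 4)"
        using x0 by (simp add: powr_add[symmetric])
      also have "\<dots> = 8 powr (\<delta> / 4) * x powr (\<delta> / 2)"
        using x0 by (simp add: powr_mult powr_powr del: powr_numeral)
      finally have D_sq: "D\<^sup>2 = C3 * x powr (\<delta> / 2)"
        by (simp add: D_def C3_def power_mult_distrib power2_eq_square mult_ac)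
      have "real (card A * card B * card U) \<le> real (card (g ` (A \<times> B \<times> U))) * (real Q / real p + 1) * D\<^sup>2"
      proof (rule card_le_card_quotients)
        fix m n u assume mem: "m \<in> A" "n \<in> B" "u \<in> U"
        have "real_of_int m * real_of_int n * real_of_int u \<le> (2 * M) * (2 * N) * real u0"
          using bounds[OF mem(1)] bounds'[OF mem(2)] mem(3) MN by (intro mult_mono) (auto simp: U_def)
        then have "real_of_int (m * n * u) \<le> 4 * T" by (simp add: T_def t_def)
        then show "m * n * u \<le> int Q" unfolding Q_def using T0 by (simp add: le_floor_iff)
        show "[u * g (m, n, u) = m * n] (mod int p)" using g[OF mem(3)] by blast
      qed (use fin sub D_bound p2 in \<open>auto simp: U_def\<close>)
      also have "\<dots> \<le> (C1 * sqrt x) * (4 * T / x + 1) * (C3 * x powr (\<delta> / 2))"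
        unfolding D_sq x_def[symmetric] using image_le Q_le x0 C1 C3 T0
        by (intro mult_mono add_mono divide_right_mono) auto
      finally have upper: "real (card A * card B * card U)
        \<le> (C1 * sqrt x) * (4 * T / x + 1) * (C3 * x powr (\<delta> / 2))" .
      have "c0\<^sup>2 * T = (c0 * M) * (c0 * N) * real u0" by (simp add: T_def t_def power2_eq_square)
      also have "\<dots> \<le> real (card A) * real (card B) * real u0"
        using dense assms(2) MN by (intro mult_right_mono mult_mono) auto
      also have "\<dots> = real (card A * card B * card U)" by (simp add: U_def)
      also note upper
      also have "(C1 * sqrt x) * (4 * T / x + 1) * (C3 * x powr (\<delta> / 2))
          = C1 * C3 * (4 * T * (x powr (1 / 2 + \<delta> / 2) / x) + x powr (1 / 2 + \<delta> / 2))"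
        unfolding powr_add using x0 by (simp add: powr_half_sqrt algebra_simps)
      \<comment> \<open>Both summands gain x^(-\<delta>/2) over \<open>T\<close>: the first because
        \<delta> \<le> 1/2, the second because \<open>T\<close> is at least x^(1/2 + \<delta>).
        Cancelling \<open>T\<close> then contradicts the choice of the threshold.\<close>
      also have "\<dots> \<le> C1 * C3 * (4 * T * x powr (- (\<delta> / 2)) + T * x powr (- (\<delta> / 2)))"
      proof (intro mult_left_mono add_mono)
        have "x powr (1 / 2 + \<delta> / 2) / x = x powr (1 / 2 + \<delta> / 2 - 1)"
          unfolding powr_diff using x0 by simp
        also have "\<dots> \<le> x powr (- (\<delta> / 2))" using x1 \<delta> by (intro powr_mono) auto
        finally show "x powr (1 / 2 + \<delta> / 2) / x \<le> x powr (- (\<delta> / 2))" .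
        have "x powr (1 / 2 + \<delta> / 2) = x powr (1 / 2 + \<delta>) * x powr (- (\<delta> / 2))"
          by (simp add: powr_add[symmetric] add.commute)
        also have "\<dots> \<le> T * x powr (- (\<delta> / 2))"
          using tu0 unfolding T_def by (intro mult_right_mono) auto
        finally show "x powr (1 / 2 + \<delta> / 2) \<le> T * x powr (- (\<delta> / 2))" .
      qed (use T0 C1 C3 in auto)
      also have "\<dots> = (5 * C1 * C3 / x powr (\<delta> / 2)) * T"
        by (simp add: powr_minus_divide algebra_simps)
      finally have "c0\<^sup>2 \<le> 5 * C1 * C3 / x powr (\<delta> / 2)"
        using T0 by (rule mult_right_le_imp_le)
      then have "x powr (\<delta> / 2) \<le> 5 * C1 * C3 / c0\<^sup>2"
        using x0 assms(2) by (simp add: field_simps)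
      then show False using large(4) by simp
    qed
  qed
qed

end
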